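(* Let $P$ be a finite bounded poset. Then the following are equivalent: (1) $P$ admits a recursive atom ordering; (2) $P$ admits a generalized recursive atom ordering; (3) $P$ admits a CL-labeling; (4) $P$ admits a CL-labeling with the UE property; (5) $P$ admits a self-consistent CC-labeling; (6) $P$ admits a CC-labeling with the UE property; (7) $P$ admits a self-consistent TCL-labeling; (8) $P$ admits a TCL-labeling with the UE property. Moreover, all of these implications are proven constructively. That is, for each implication, either a construction is given showing how to construct the latter type of object from the former, or else the former type of object is proven also to be the latter type of object.
   Context: Posets are finite and bounded (least element $\hat 0$, greatest element $\hat 1$), not necessarily graded. $u\lessdot v$ denotes a cover relation. The atoms of $P$ (resp. of $[u,v]$) are the elements of $P$ (resp. of $[u,v]$) covering $\hat 0$ (resp. $u$). The length of a chain $u_1<\cdots<u_k$ is $k-1$; the length of a poset is the length of its longest chain. A saturated chain from $u$ to $v$ is a maximal chain of $[u,v]$; the saturated chains of $[u,v]$ means the maximal chains of $[u,v]$. A rooted interval $[u,v]_r$ is an interval $[u,v]$ together with a root $r$, a saturated chain from $\hat 0$ to $u$. A chain-atom ordering of $P$ is a choice of ordering on the atoms of each rooted interval $[u,\hat 1]_r$ of $P$; it restricts to each $[u,v]_r$. Recursive atom ordering (RAO): $P$ admits an RAO if $P$ has length 1 or its atoms can be ordered $a_1,\dots,a_t$ so that: (i)(a) for all $j$, $[a_j,\hat 1]$ admits an RAO; (i)(b) for $j\neq 1$, the atoms coming first in this RAO for $[a_j,\hat 1]$ are those that are greater than some atom $a_k$ of $P$ with $k<j$; (ii) for all $i<j$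 and $y\in P$ with $y>a_i$ and $y>a_j$ there exist $k<j$ and $z\in P$ with $a_j\lessdot z$ and $a_k<z\le y$. Generalized recursive atom ordering (GRAO): $P$ admits a GRAO if $P$ has length 1, or $P$ has length greater than 1 and there is an ordering $a_1,\dots,a_t$ of its atoms such that: (i)(a) for $1\le j\le t$, $[a_j,\hat 1]$ admits a GRAO; (i)(b) for any atom $a_j$ and any $x,w\in P$ with $a_j\lessdot x\lessdot w$, when the chain-atom ordering given by the GRAO from (i)(a) is restricted to $[a_j,w]$, either the first atom of $[a_j,w]$ is above an atom $a_i$ with $i<j$, or no atom of $[a_j,w]$ is above any atom $a_i$ with $i<j$; (ii) for any $y\in P$ and atoms $a_i,a_j$ with $a_i<y$, $a_j<y$ and $i<j$, there exist $z\in P$ with $z\le y$ and an atom $a_k$ with $k<j$ such that $a_j\lessdot z$ and $a_k<z$. Chain-edge labelings: Let $E^*(P)=\{(c,x,y): c \text{ a maximal chain of } P,\ x,y\in c,\ x\lessdot y\}$ and let $Q$ be a poset. A chain-edge labeling is a map $\lambda:E^*(P)\to Q$ such that whenever two maximal chains coincide along their first $d$ edges, they have the same labels on these $d$ edges. Hence for each root $r$ of $u$ and each saturated chain $c$ from $u$ to $v$ there is a well-defined label sequence $\lambda_r(c)$. Label sequences are compared lexicographically (dictionary order); "lexicographically earliest/first/smallest" means earlier than all others. CL-labeling: a chain-edge labeling such that for every rooted interval $[x,y]_r$ there is a unique maximal chain $c$ of $[x,y]_r$ that is ascending (its consecutive labels satisfy $\lambda_i<\lambda_{i+1}$ in $Q$),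 and the label sequence $\lambda_r(c)$ lexicographically precedes the label sequence of every other maximal chain of $[x,y]_r$. Topological ascents/descents: $u\lessdot v\lessdot w$ is a topological ascent with respect to root $r$ (of $u$) if its label pair is lexicographically earlier than the label sequences of all other saturated chains from $u$ to $w$ with the same root $r$; otherwise it is a topological descent. CC-labeling: a chain-edge labeling such that (1) every rooted interval $[u,v]_r$ has a unique saturated chain from $u$ to $v$ consisting entirely of topological ascents, and (2) the label sequences of the saturated chains of $[u,v]_r$ are all distinct with none being a prefix of another. TCL-labeling: a chain-edge labeling such that (i) each rooted interval $[u,v]_r$ has a unique saturated chain from $u$ to $v$ with lexicographically smallest label sequence, and (ii) every other saturated chain from $u$ to $v$ in $[u,v]_r$ has at least one topological descent. Self-consistent: a chain-edge labeling in which each rooted interval has a unique lexicographically earliest saturated chain is self-consistent if for any rooted interval $[u,v]_r$: if $a$ is the atom in the lexicographically first saturated chain of $[u,v]_r$ and $b\ne a$ is also an atom of $[u,v]_r$, then for any $[u,v']_r$ containing $a$ and $b$, all saturated chains of $[u,v']_r$ containing $b$ come lexicographically later than all saturated chains of $[u,v']_r$ containing $a$. UE (unique earliest) property: for each rooted interval $[u,v]_r$, the smallest label occurring on any cover relation upward from $u$ (in $[u,v]_r$) occurs on only one such cover relation. *)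

theory Defs
  imports Main "HOL-Library.Sublist"
begin

section \<open>Finite bounded posets, intervals and chains\<close>

text \<open>A poset is a subset of an ordered type, with the induced order. Its bottom and top elements
  are \<open>LEAST x. x \<in> S\<close> and \<open>GREATEST x. x \<in> S\<close>.\<close>

definition finite_bounded_poset :: "'a::order set \<Rightarrow> bool" where
  "finite_bounded_poset S \<longleftrightarrow>
     finite S \<and> (\<exists>b\<in>S. \<forall>x\<in>S. b \<le> x) \<and> (\<exists>t\<in>S. \<forall>x\<in>S. x \<le> t)"

abbreviation pbot :: "'a::order set \<Rightarrow> 'a" where
  "pbot S \<equiv> (LEAST x. x \<in> S)"

abbreviation ptop :: "'a::order set \<Rightarrow> 'a" where
  "ptop S \<equiv> (GREATEST x. x \<in> S)"

definition covers :: "'a::order set \<Rightarrow> 'a \<Rightarrow> 'a \<Rightarrow> bool" where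
  "covers S x y \<longleftrightarrow> x \<in> S \<and> y \<in> S \<and> x < y \<and> \<not> (\<exists>z\<in>S. x < z \<and> z < y)"

definition interval :: "'a::order set \<Rightarrow> 'a \<Rightarrow> 'a \<Rightarrow> 'a set" where
  "interval S u v = {x \<in> S. u \<le> x \<and> x \<le> v}"

definition atoms :: "'a::order set \<Rightarrow> 'a set" where
  "atoms S = {a. covers S (pbot S) a}"

text \<open>Chains \<open>u\<^sub>1 < \<dots> < u\<^sub>k\<close> are listed in increasing order; maximality is with respect to inclusion.\<close>

definition chain_in :: "'a::order set \<Rightarrow> 'a list \<Rightarrow> bool" where
  "chain_in S c \<longleftrightarrow> set c \<subseteq> S \<and> sorted_wrt (<) c"

definition maximal_chain :: "'a::order set \<Rightarrow> 'a list \<Rightarrow> bool" where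
  "maximal_chain S c \<longleftrightarrow>
     chain_in S c \<and> (\<forall>d. chain_in S d \<and> set c \<subseteq> set d \<longrightarrow> set d = set c)"

definition poset_length :: "'a::order set \<Rightarrow> nat" where
  "poset_length S = Max {length c - 1 | c. chain_in S c \<and> c \<noteq> []}"

abbreviation saturated_chain :: "'a::order set \<Rightarrow> 'a \<Rightarrow> 'a \<Rightarrow> 'a list \<Rightarrow> bool" where
  "saturated_chain P u v c \<equiv> maximal_chain (interval P u v) c"

definition rooted_interval :: "'a::order set \<Rightarrow> 'a \<Rightarrow> 'a \<Rightarrow> 'a list \<Rightarrow> bool" where
  "rooted_interval P u v r \<longleftrightarrow>
     u \<in> P \<and> v \<in> P \<and> u \<le> v \<and> saturated_chain P (pbot P) u r"


section \<open>Recursive and generalized recursive atom orderings\<close>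

definition atom_ordering :: "'a::order set \<Rightarrow> 'a list \<Rightarrow> bool" where
  "atom_ordering S as \<longleftrightarrow> distinct as \<and> set as = atoms S"

text \<open>\<open>rao S as\<close>: the poset \<open>S\<close> has a recursive atom ordering whose ordering of the atoms of \<open>S\<close>
  is \<open>as\<close>. Positions are counted from 0, so the first atom is \<open>as ! 0\<close>.
  The orderings at deeper levels are existentially quantified; only the ordering \<open>bs\<close> of the
  atoms of \<open>[a\<^sub>j, 1]\<close> interacts with \<open>as\<close>. The same holds for \<open>grao\<close> below.\<close>

inductive rao :: "'a::order set \<Rightarrow> 'a list \<Rightarrow> bool" where
  rao_length_one:
    "poset_length S = 1 \<Longrightarrow> atom_ordering S as \<Longrightarrow> rao S as"
| rao_step:
    "atom_ordering S as \<Longrightarrow>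
     (\<forall>j < length as. \<exists>bs.
        rao (interval S (as ! j) (ptop S)) bs \<and>
        (j \<noteq> 0 \<longrightarrow>
           (\<exists>m. set (take m bs) =
                {x \<in> atoms (interval S (as ! j) (ptop S)). \<exists>k<j. as ! k < x}))) \<Longrightarrow>
     (\<forall>i j y. i < j \<and> j < length as \<and> y \<in> S \<and> as ! i < y \<and> as ! j < y \<longrightarrow>
        (\<exists>k<j. \<exists>z\<in>S. covers S (as ! j) z \<and> as ! k < z \<and> z \<le> y)) \<Longrightarrow>
     rao S as"

definition admits_RAO :: "'a::order set \<Rightarrow> bool" where
  "admits_RAO P \<longleftrightarrow> (\<exists>as. rao P as)"

text \<open>The ordering \<open>bs\<close> of the atoms of \<open>[a\<^sub>j, 1]\<close> restricts to the ordering
  \<open>filter (\<lambda>b. b \<le> w) bs\<close> of the atoms of \<open>[a\<^sub>j, w]\<close>.\<close>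

inductive grao :: "'a::order set \<Rightarrow> 'a list \<Rightarrow> bool" where
  grao_length_one:
    "poset_length S = 1 \<Longrightarrow> atom_ordering S as \<Longrightarrow> grao S as"
| grao_step:
    "poset_length S > 1 \<Longrightarrow>
     atom_ordering S as \<Longrightarrow>
     (\<forall>j < length as. \<exists>bs.
        grao (interval S (as ! j) (ptop S)) bs \<and>
        (\<forall>x w. covers S (as ! j) x \<and> covers S x w \<longrightarrow>
           (\<exists>i<j. as ! i < hd (filter (\<lambda>b. b \<le> w) bs)) \<or>
           (\<forall>b \<in> set (filter (\<lambda>b. b \<le> w) bs). \<not> (\<exists>i<j. as ! i < b)))) \<Longrightarrow>
     (\<forall>i j y. i < j \<and> j < length as \<and> y \<in> S \<and> as ! i < y \<and> as ! j < y \<longrightarrow>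
        (\<exists>k<j. \<exists>z\<in>S. z \<le> y \<and> covers S (as ! j) z \<and> as ! k < z)) \<Longrightarrow>
     grao S as"

definition admits_GRAO :: "'a::order set \<Rightarrow> bool" where
  "admits_GRAO P \<longleftrightarrow> (\<exists>as. grao P as)"


section \<open>Chain-edge labelings\<close>

definition chain_edges :: "'a::order set \<Rightarrow> ('a list \<times> 'a \<times> 'a) set" where
  "chain_edges P = {(c, x, y). maximal_chain P c \<and> x \<in> set c \<and> y \<in> set c \<and> covers P x y}"

text \<open>Labels lie in a poset with carrier \<open>Q\<close> and (reflexive) order relation \<open>R\<close>. A chain with
  \<open>d\<close> edges has \<open>d + 1\<close> elements, so the first \<open>d\<close> edges of \<open>c\<close> are those of \<open>take (Suc d) c\<close>.

  HOL cannot quantify existentially over the label poset together with its type. This is no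
  restriction when \<open>'q\<close> is infinite: \<open>P\<close> being finite, only finitely many labels occur, and every
  finite poset is isomorphic to one with carrier \<open>Q \<subseteq> UNIV\<close> in \<open>'q\<close>.\<close>

definition chain_edge_labeling ::
  "'a::order set \<Rightarrow> 'q set \<Rightarrow> 'q rel \<Rightarrow> ('a list \<times> 'a \<times> 'a \<Rightarrow> 'q) \<Rightarrow> bool" where
  "chain_edge_labeling P Q R lam \<longleftrightarrow>
     partial_order_on Q R \<and>
     (\<forall>e \<in> chain_edges P. lam e \<in> Q) \<and>
     (\<forall>c c' d. maximal_chain P c \<and> maximal_chain P c' \<and> d < length c \<and> d < length c' \<and>
        take (Suc d) c = take (Suc d) c' \<longrightarrow>
        (\<forall>i<d. lam (c, c ! i, c ! Suc i) = lam (c', c' ! i, c' ! Suc i)))"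

text \<open>For a root \<open>r\<close> of \<open>u\<close> and a saturated chain \<open>c\<close> starting at \<open>u\<close>, the chain \<open>r @ tl c\<close> is
  the concatenation of \<open>r\<close> and \<open>c\<close>, whose common element \<open>u\<close> is listed once. By the definition of
  a chain-edge labeling, the labels do not depend on the maximal chain chosen to extend it.\<close>

definition label_seq ::
  "'a::order set \<Rightarrow> ('a list \<times> 'a \<times> 'a \<Rightarrow> 'q) \<Rightarrow> 'a list \<Rightarrow> 'a list \<Rightarrow> 'q list" where
  "label_seq P lam r c =
     (let m = (SOME m. maximal_chain P m \<and> prefix (r @ tl c) m)
      in map (\<lambda>i. lam (m, c ! i, c ! Suc i)) [0..<length c - 1])"

text \<open>Dictionary order, in which a proper prefix comes earlier; it is only a partial order in
  general, as \<open>R\<close> need not be total.\<close>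

definition lex_earlier :: "'q rel \<Rightarrow> 'q list \<Rightarrow> 'q list \<Rightarrow> bool" where
  "lex_earlier R s t \<longleftrightarrow> (s, t) \<in> lexord (R - Id)"

definition lex_first ::
  "'a::order set \<Rightarrow> 'q rel \<Rightarrow> ('a list \<times> 'a \<times> 'a \<Rightarrow> 'q) \<Rightarrow> 'a \<Rightarrow> 'a \<Rightarrow> 'a list \<Rightarrow> 'a list \<Rightarrow> bool"
where
  "lex_first P R lam u v r c \<longleftrightarrow>
     saturated_chain P u v c \<and>
     (\<forall>d. saturated_chain P u v d \<and> d \<noteq> c \<longrightarrow>
        lex_earlier R (label_seq P lam r c) (label_seq P lam r d))"

definition ascending ::
  "'a::order set \<Rightarrow> 'q rel \<Rightarrow> ('a list \<times> 'a \<times> 'a \<Rightarrow> 'q) \<Rightarrow> 'a list \<Rightarrow> 'a list \<Rightarrow> bool" where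
  "ascending P R lam r c \<longleftrightarrow>
     successively (\<lambda>k l. (k, l) \<in> R \<and> k \<noteq> l) (label_seq P lam r c)"

definition CL_labeling ::
  "'a::order set \<Rightarrow> 'q set \<Rightarrow> 'q rel \<Rightarrow> ('a list \<times> 'a \<times> 'a \<Rightarrow> 'q) \<Rightarrow> bool" where
  "CL_labeling P Q R lam \<longleftrightarrow>
     chain_edge_labeling P Q R lam \<and>
     (\<forall>x y r. rooted_interval P x y r \<longrightarrow>
        (\<exists>!c. saturated_chain P x y c \<and> ascending P R lam r c) \<and>
        (\<forall>c. saturated_chain P x y c \<and> ascending P R lam r c \<longrightarrow> lex_first P R lam x y r c))"

definition topological_ascent ::
  "'a::order set \<Rightarrow> 'q rel \<Rightarrow> ('a list \<times> 'a \<times> 'a \<Rightarrow> 'q) \<Rightarrow> 'a list \<Rightarrow> 'a \<Rightarrow> 'a \<Rightarrow> 'a \<Rightarrow> bool" where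
  "topological_ascent P R lam r u v w \<longleftrightarrow>
     covers P u v \<and> covers P v w \<and>
     (\<forall>d. saturated_chain P u w d \<and> d \<noteq> [u, v, w] \<longrightarrow>
        lex_earlier R (label_seq P lam r [u, v, w]) (label_seq P lam r d))"

definition topological_descent ::
  "'a::order set \<Rightarrow> 'q rel \<Rightarrow> ('a list \<times> 'a \<times> 'a \<Rightarrow> 'q) \<Rightarrow> 'a list \<Rightarrow> 'a \<Rightarrow> 'a \<Rightarrow> 'a \<Rightarrow> bool" where
  "topological_descent P R lam r u v w \<longleftrightarrow>
     covers P u v \<and> covers P v w \<and> \<not> topological_ascent P R lam r u v w"

text \<open>Along a chain \<open>c\<close> with root \<open>r\<close>, the root of \<open>c ! i\<close> is \<open>r\<close> followed by \<open>c\<close> up to \<open>c ! i\<close>.\<close>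

definition all_topological_ascents ::
  "'a::order set \<Rightarrow> 'q rel \<Rightarrow> ('a list \<times> 'a \<times> 'a \<Rightarrow> 'q) \<Rightarrow> 'a list \<Rightarrow> 'a list \<Rightarrow> bool" where
  "all_topological_ascents P R lam r c \<longleftrightarrow>
     (\<forall>i. i + 2 < length c \<longrightarrow>
        topological_ascent P R lam (r @ tl (take (Suc i) c)) (c ! i) (c ! (i + 1)) (c ! (i + 2)))"

definition has_topological_descent ::
  "'a::order set \<Rightarrow> 'q rel \<Rightarrow> ('a list \<times> 'a \<times> 'a \<Rightarrow> 'q) \<Rightarrow> 'a list \<Rightarrow> 'a list \<Rightarrow> bool" where
  "has_topological_descent P R lam r c \<longleftrightarrow>
     (\<exists>i. i + 2 < length c \<and>
        topological_descent P R lam (r @ tl (take (Suc i) c)) (c ! i) (c ! (i + 1)) (c ! (i + 2)))"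

definition CC_labeling ::
  "'a::order set \<Rightarrow> 'q set \<Rightarrow> 'q rel \<Rightarrow> ('a list \<times> 'a \<times> 'a \<Rightarrow> 'q) \<Rightarrow> bool" where
  "CC_labeling P Q R lam \<longleftrightarrow>
     chain_edge_labeling P Q R lam \<and>
     (\<forall>u v r. rooted_interval P u v r \<longrightarrow>
        (\<exists>!c. saturated_chain P u v c \<and> all_topological_ascents P R lam r c) \<and>
        (\<forall>c d. saturated_chain P u v c \<and> saturated_chain P u v d \<and> c \<noteq> d \<longrightarrow>
           label_seq P lam r c \<noteq> label_seq P lam r d \<and>
           \<not> prefix (label_seq P lam r c) (label_seq P lam r d)))"

definition TCL_labeling ::
  "'a::order set \<Rightarrow> 'q set \<Rightarrow> 'q rel \<Rightarrow> ('a list \<times> 'a \<times> 'a \<Rightarrow> 'q) \<Rightarrow> bool" where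
  "TCL_labeling P Q R lam \<longleftrightarrow>
     chain_edge_labeling P Q R lam \<and>
     (\<forall>u v r. rooted_interval P u v r \<longrightarrow>
        (\<exists>!c. lex_first P R lam u v r c) \<and>
        (\<forall>d. saturated_chain P u v d \<and> \<not> lex_first P R lam u v r d \<longrightarrow>
           has_topological_descent P R lam r d))"

definition self_consistent ::
  "'a::order set \<Rightarrow> 'q rel \<Rightarrow> ('a list \<times> 'a \<times> 'a \<Rightarrow> 'q) \<Rightarrow> bool" where
  "self_consistent P R lam \<longleftrightarrow>
     (\<forall>u v r. rooted_interval P u v r \<longrightarrow> (\<exists>!c. lex_first P R lam u v r c)) \<and>
     (\<forall>u v r c a b.
        rooted_interval P u v r \<and> lex_first P R lam u v r c \<and>
        a \<in> atoms (interval P u v) \<and> a \<in> set c \<and>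
        b \<in> atoms (interval P u v) \<and> b \<noteq> a \<longrightarrow>
        (\<forall>v'. rooted_interval P u v' r \<and> a \<in> interval P u v' \<and> b \<in> interval P u v' \<longrightarrow>
           (\<forall>ca cb. saturated_chain P u v' ca \<and> a \<in> set ca \<and>
                    saturated_chain P u v' cb \<and> b \<in> set cb \<longrightarrow>
              lex_earlier R (label_seq P lam r ca) (label_seq P lam r cb))))"

text \<open>The smallest label is the minimum, required to exist, of the labels of the covers
  \<open>u < a\<close> in \<open>[u, v]\<close>; such covers exist only if \<open>u < v\<close>.\<close>

definition UE_property ::
  "'a::order set \<Rightarrow> 'q rel \<Rightarrow> ('a list \<times> 'a \<times> 'a \<Rightarrow> 'q) \<Rightarrow> bool" where
  "UE_property P R lam \<longleftrightarrow>
     (\<forall>u v r. rooted_interval P u v r \<and> u < v \<longrightarrow>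
        (\<exists>l. (\<forall>a \<in> atoms (interval P u v). (l, hd (label_seq P lam r [u, a])) \<in> R) \<and>
             (\<exists>!a. a \<in> atoms (interval P u v) \<and> hd (label_seq P lam r [u, a]) = l)))"

end

(*
  Every labeling of the theorem is a self-consistent TCL-labeling. A CL-labeling has the UE property
  automatically: if a second atom b shared the first label of the ascending chain of an interval, the
  lexicographically first chain through b would be ascending as well. The UE property implies
  self-consistency, and a lexicographically first chain consists of topological ascents.

  For a self-consistent TCL-labeling, "all maximal chains through a are earlier than all those
  through b" is a strict partial order on the atoms of a rooted interval [u, 1], and any linear
  extension of it is the first level of a GRAO, since the first atom of [u, v] in it starts the
  lexicographically first chain of [u, v].

  A GRAO becomes an RAO by moving to the front of the ordering of the atoms of [a, 1], one level
  after the other, those atoms that lie above a predecessor of a; this preserves the GRAO conditions.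

  From an RAO, integer labels that go down exactly at the atoms above a predecessor and increase along
  the orderings give a labeling with all properties at once; distinct atoms have distinct labels.
*)
theory Submission
  imports Defs "HOL-Library.Nat_Bijection"
begin

section \<open>Intervals and saturated chains\<close>

text \<open>Labels are only partially ordered, so a chain that is not lexicographically first need
  not come after any other chain. Exchange arguments therefore start from an existing first chain of
  the interval in question: the ascending chain for a CL-labeling, a greedy choice of atoms under
  UE, the definition itself under self-consistency.

  The passage from labelings to atom orderings rests on one observation. Suppose the first chain of
  [a, y] leaves \<open>a\<close> towards an element that is above no predecessor of
  \<open>a\<close>. Then prepending \<open>u\<close> yields topological ascents only, the longer
  chain is first in [u, y], and no atom below \<open>y\<close> precedes \<open>a\<close>.

  In the labeling built from an RAO, the label of an edge is the label of the edge below it plus a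
  nonzero offset, negative exactly at the atoms above a predecessor. Such sums can become negative,
  hence integers; dropping relative to the preceding edge makes the label depend on the whole
  root.\<close>

lemma pbot_eqI: "b \<in> S \<Longrightarrow> (\<And>x. x \<in> S \<Longrightarrow> b \<le> x) \<Longrightarrow> pbot S = b"
  by (rule Least_equality)

lemma ptop_eqI: "t \<in> S \<Longrightarrow> (\<And>x. x \<in> S \<Longrightarrow> x \<le> t) \<Longrightarrow> ptop S = t"
  by (rule Greatest_equality)

lemma finite_bounded_posetD:
  assumes "finite_bounded_poset S"
  shows "finite S" "pbot S \<in> S" "ptop S \<in> S"
    "x \<in> S \<Longrightarrow> pbot S \<le> x" "x \<in> S \<Longrightarrow> x \<le> ptop S"
proof -
  obtain b where b: "b \<in> S" "\<forall>x\<in>S. b \<le> x"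
    using assms by (auto simp: finite_bounded_poset_def)
  obtain t where t: "t \<in> S" "\<forall>x\<in>S. x \<le> t"
    using assms by (auto simp: finite_bounded_poset_def)
  have bt: "pbot S = b" "ptop S = t"
    using b t by (auto intro: pbot_eqI ptop_eqI)
  show "finite S" using assms by (simp add: finite_bounded_poset_def)
  show "pbot S \<in> S" "ptop S \<in> S" using b t bt by simp_all
  show "x \<in> S \<Longrightarrow> pbot S \<le> x" "x \<in> S \<Longrightarrow> x \<le> ptop S" using b t bt by simp_all
qed

lemma pbot_interval: "u \<in> S \<Longrightarrow> u \<le> v \<Longrightarrow> pbot (interval S u v) = u"
  by (rule pbot_eqI) (auto simp: interval_def)

lemma ptop_interval: "v \<in> S \<Longrightarrow> u \<le> v \<Longrightarrow> ptop (interval S u v) = v"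
  by (rule ptop_eqI) (auto simp: interval_def)

lemma finite_bounded_poset_interval:
  assumes "finite S" "u \<in> S" "v \<in> S" "u \<le> v"
  shows "finite_bounded_poset (interval S u v)"
  unfolding finite_bounded_poset_def
  using assms by (auto simp: interval_def)

lemma coversD: "covers S x y \<Longrightarrow> x \<in> S \<and> y \<in> S \<and> x < y"
  by (simp add: covers_def)

lemma covers_interval:
  "covers (interval S u v) x y \<longleftrightarrow> covers S x y \<and> u \<le> x \<and> y \<le> v"
  unfolding covers_def interval_def by (auto dest: order.strict_trans1 order.strict_trans2)

lemma interval_interval:
  "u \<le> a \<Longrightarrow> b \<le> v \<Longrightarrow> interval (interval S u v) a b = interval S a b"
  unfolding interval_def by (auto dest: order_trans)

lemma atoms_interval:
  "u \<in> S \<Longrightarrow> u \<le> v \<Longrightarrow> atoms (interval S u v) = {a. covers S u a \<and> a \<le> v}"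
  by (auto simp: atoms_def pbot_interval covers_interval)

lemma ex_cover_le:
  assumes "finite S" "u \<in> S" "v \<in> S" "u < v"
  shows "\<exists>a. covers S u a \<and> a \<le> v"
proof -
  let ?A = "{x \<in> S. u < x \<and> x \<le> v}"
  have "finite ?A" "v \<in> ?A" using assms by auto
  then obtain a where a: "a \<in> ?A" "\<forall>b\<in>?A. b \<le> a \<longrightarrow> a = b"
    using finite_has_minimal2[of ?A v] by blast
  have "covers S u a"
    unfolding covers_def
  proof (intro conjI notI)
    assume "\<exists>z\<in>S. u < z \<and> z < a"
    then obtain z where "z \<in> S" "u < z" "z < a" by blast
    moreover from this have "z \<in> ?A" using a(1) by auto
    ultimately show False using a(2) by auto
  qed (use a assms in auto)
  then show ?thesis using a by blast
qed

text \<open>The number of elements strictly above \<open>u\<close> drops along every cover, so this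
  is induction from the top downwards. It suits intervals with a fixed upper end.\<close>

lemma cover_induct [consumes 1, case_names step]:
  assumes "finite S" and "\<And>u. (\<And>a. covers S u a \<Longrightarrow> Q a) \<Longrightarrow> Q u"
  shows "Q u"
proof (induction "card {x \<in> S. u < x}" arbitrary: u rule: less_induct)
  case less
  show ?case
  proof (rule assms(2))
    fix a assume a: "covers S u a"
    have "{x \<in> S. a < x} \<subset> {x \<in> S. u < x}"
      using coversD[OF a] by auto
    then show "Q a" using assms(1) less by (simp add: psubset_card_mono)
  qed
qed

text \<open>Maximality under inclusion gives no recursion along a chain, whereas a list whose
  neighbours are covers does. \<open>saturated_chain_iff\<close> identifies the two
  descriptions.\<close>

fun path :: "'a::order set \<Rightarrow> 'a \<Rightarrow> 'a \<Rightarrow> 'a list \<Rightarrow> bool" where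
  "path S u v [] \<longleftrightarrow> False"
| "path S u v [x] \<longleftrightarrow> x = u \<and> u = v"
| "path S u v (x # y # c) \<longleftrightarrow> x = u \<and> covers S u y \<and> path S y v (y # c)"

lemma path_hd: "path S u v c \<Longrightarrow> \<exists>c'. c = u # c'"
  by (induction S u v c rule: path.induct) auto

lemma path_last: "path S u v c \<Longrightarrow> last c = v"
  by (induction S u v c rule: path.induct) auto

lemma path_le: "path S u v c \<Longrightarrow> u \<le> v"
  by (induction S u v c rule: path.induct) (auto dest!: coversD)

lemma path_set: "path S u v c \<Longrightarrow> x \<in> set c \<Longrightarrow> u \<le> x \<and> x \<le> v"
  by (induction S u v c rule: path.induct) (auto dest!: coversD dest: path_le)

lemma path_mem: "path S u v c \<Longrightarrow> u \<in> S \<Longrightarrow> set c \<subseteq> S"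
  by (induction S u v c rule: path.induct) (auto dest!: coversD)

lemma path_mem_last: "path S u v c \<Longrightarrow> u \<in> S \<Longrightarrow> v \<in> S"
  using path_mem[of S u v c] path_last[of S u v c] path_hd[of S u v c] last_in_set by blast

lemma path_sorted: "path S u v c \<Longrightarrow> sorted_wrt (<) c"
proof (induction S u v c rule: path.induct)
  case (3 S u v x y c)
  then have "path S y v (y # c)" and "u < y" by (auto dest: coversD)
  then show ?case using 3 path_set[of S y v "y # c"] by (auto intro: less_le_trans)
qed auto

lemma path_same: "path S u u c \<longleftrightarrow> c = [u]"
proof
  assume p: "path S u u c"
  show "c = [u]"
  proof (cases "(S, u, u, c)" rule: path.cases)
    case (3 S' u' v x y c')
    then show ?thesis using p by (auto dest!: coversD path_le)
  qed (use p in auto)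
qed simp

lemma path_cover: "covers S u v \<Longrightarrow> path S u v c \<longleftrightarrow> c = [u, v]"
proof
  assume uv: "covers S u v" and p: "path S u v c"
  show "c = [u, v]"
  proof (cases "(S, u, v, c)" rule: path.cases)
    case (3 S' u' v' x y c')
    then have y: "covers S u y" "path S y v (y # c')" using p by auto
    then have "y = v" using uv path_le[OF y(2)] by (auto simp: covers_def less_le)
    then show ?thesis using 3 y p by (auto simp: path_same)
  qed (use p uv in \<open>auto dest: coversD\<close>)
qed (auto simp: path_same)

lemma path_neqE:
  assumes "path S u v c" "u \<noteq> v"
  obtains a c' where "c = u # a # c'" "covers S u a" "path S a v (a # c')"
  using assms by (cases "(S, u, v, c)" rule: path.cases) auto

lemma path_append: "path S u v c \<Longrightarrow> path S v w d \<Longrightarrow> path S u w (c @ tl d)"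
proof (induction S u v c rule: path.induct)
  case (2 S u v x)
  then show ?case using path_hd by fastforce
qed auto

lemma path_snoc: "path S u v c \<Longrightarrow> covers S v w \<Longrightarrow> path S u w (c @ [w])"
  using path_append[of S u v c w "[v, w]"] by auto

lemma ex_path:
  assumes "finite S" "u \<in> S" "v \<in> S" "u \<le> v"
  shows "\<exists>c. path S u v c"
  using assms(1,2,4)
proof (induction u rule: cover_induct)
  case (step u)
  show ?case
  proof (cases "u = v")
    case True
    then show ?thesis by (metis path.simps(2))
  next
    case False
    then have "u < v" using step by simp
    then obtain a where a: "covers S u a" "a \<le> v"
      using ex_cover_le[of S u v] assms step by blast
    then obtain c where c: "path S a v c"
      using step coversD by blast
    have "path S u a [u, a]" using a by simp
    then show ?thesis using path_append c by blast
  qed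
qed

text \<open>Gaps are filled one at a time: a path from \<open>u\<close> to the head \<open>x\<close>
  of the chain, continued by a refinement of the remaining chain inside [x, v].\<close>

lemma ex_path_through:
  assumes "finite S" "u \<in> S" "v \<in> S" "u \<le> v" "chain_in (interval S u v) c"
  shows "\<exists>p. path S u v p \<and> set c \<subseteq> set p"
  using assms(2,4,5)
proof (induction c arbitrary: u)
  case Nil
  then show ?case using ex_path assms by fastforce
next
  case (Cons x c)
  then have x: "x \<in> S" "u \<le> x" "x \<le> v" by (auto simp: chain_in_def interval_def)
  have "chain_in (interval S x v) c"
    using Cons.prems by (auto simp: chain_in_def interval_def)
  then obtain p where p: "path S x v p" "set c \<subseteq> set p" using Cons x by blast
  obtain q where q: "path S u x q" using ex_path assms Cons.prems x by blast
  have "x \<in> set q" using path_last[OF q] path_hd[OF q] last_in_set by blast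
  moreover have "set p \<subseteq> insert x (set (tl p))" using path_hd[OF p(1)] by auto
  ultimately have "set (x # c) \<subseteq> set (q @ tl p)" using p by auto
  then show ?case using path_append[OF q p(1)] by blast
qed

lemma sorted_wrt_less_unique:
  fixes c d :: "'a::order list"
  assumes "sorted_wrt (<) c" "sorted_wrt (<) d" "set c = set d"
  shows "c = d"
  using assms
proof (induction c arbitrary: d)
  case (Cons x c)
  then obtain y d' where d: "d = y # d'" by (cases d) auto
  have "x = y"
  proof (rule ccontr)
    assume "x \<noteq> y"
    then have "x \<in> set d'" "y \<in> set c" using Cons.prems d by auto
    then show False using Cons.prems d by (auto dest: order.asym)
  qed
  moreover have "x \<notin> set c" "y \<notin> set d'" using Cons.prems d by auto
  ultimately have "set c = set d'" using Cons.prems d by auto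
  then show ?case using Cons d \<open>x = y\<close> by auto
qed auto

lemma sorted_wrt_less_comparable:
  fixes c :: "'a::order list"
  assumes "sorted_wrt (<) c" "x \<in> set c" "y \<in> set c"
  shows "x \<le> y \<or> y \<le> x"
  using assms by (induction c) auto

text \<open>An element comparable with the second element \<open>y\<close> of the path is either
  above it, where the induction applies, or strictly below it, and then the cover forces
  \<open>x = u\<close>.\<close>

lemma path_maximal:
  assumes "path S u v c" "x \<in> S" "u \<le> x" "x \<le> v" "\<forall>y\<in>set c. x \<le> y \<or> y \<le> x"
  shows "x \<in> set c"
  using assms
proof (induction S u v c rule: path.induct)
  case (3 S u v z y c)
  then have y: "covers S u y" "path S y v (y # c)" by auto
  show ?case
  proof (cases "y \<le> x")
    case True
    then show ?thesis using 3 y by auto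
  next
    case False
    then have "x < y" using 3 by auto
    then have "x = u" using y 3 by (auto simp: covers_def less_le)
    then show ?thesis using 3 by auto
  qed
qed auto

text \<open>A maximal chain has the same elements as any path refining it, and an increasing list is
  determined by its elements. Conversely, an element that could be added to a path would be
  comparable with all of it.\<close>

lemma saturated_chain_iff:
  assumes "finite S" "u \<in> S" "v \<in> S" "u \<le> v"
  shows "saturated_chain S u v c \<longleftrightarrow> path S u v c"
proof
  assume m: "saturated_chain S u v c"
  then have c: "chain_in (interval S u v) c" by (simp add: maximal_chain_def)
  then obtain p where p: "path S u v p" "set c \<subseteq> set p"
    using ex_path_through assms by blast
  have "chain_in (interval S u v) p"
    using path_set[OF p(1)] path_mem[OF p(1)] path_sorted[OF p(1)] assms
    by (auto simp: chain_in_def interval_def)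
  then have "set p = set c" using m p by (simp add: maximal_chain_def)
  then have "p = c"
    using c path_sorted[OF p(1)] by (auto simp: chain_in_def intro: sorted_wrt_less_unique)
  then show "path S u v c" using p by simp
next
  assume p: "path S u v c"
  show "saturated_chain S u v c"
    unfolding maximal_chain_def
  proof (intro conjI allI impI)
    show "chain_in (interval S u v) c"
      using path_set[OF p(1)] path_mem[OF p(1)] path_sorted[OF p(1)] assms
      by (auto simp: chain_in_def interval_def)
    fix d assume d: "chain_in (interval S u v) d \<and> set c \<subseteq> set d"
    have "x \<in> set c" if x: "x \<in> set d" for x
    proof (rule path_maximal[OF p])
      show "\<forall>y\<in>set c. x \<le> y \<or> y \<le> x"
        using x d sorted_wrt_less_comparable[of d x] by (auto simp: chain_in_def)
    qed (use x d in \<open>auto simp: chain_in_def interval_def\<close>)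
    then show "set d = set c" using d by blast
  qed
qed

section \<open>Label sequences of rooted chains\<close>

locale bounded_poset =
  fixes P :: "'a::order set"
  assumes fbp: "finite_bounded_poset P"
begin

lemmas finP = finite_bounded_posetD(1)[OF fbp]
  and bot_mem = finite_bounded_posetD(2)[OF fbp]
  and top_mem = finite_bounded_posetD(3)[OF fbp]
  and bot_le = finite_bounded_posetD(4)[OF fbp]
  and le_top = finite_bounded_posetD(5)[OF fbp]

abbreviation "root r u \<equiv> path P (pbot P) u r"

lemma root_mem: "root r u \<Longrightarrow> u \<in> P"
  using path_mem_last bot_mem by blast

lemma rooted_interval_iff:
  "rooted_interval P u v r \<longleftrightarrow> v \<in> P \<and> u \<le> v \<and> root r u"
  unfolding rooted_interval_def
  using saturated_chain_iff[OF finP bot_mem] bot_le root_mem by blast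

lemma sat_iff: "rooted_interval P u v r \<Longrightarrow> saturated_chain P u v c \<longleftrightarrow> path P u v c"
  using saturated_chain_iff[OF finP] rooted_interval_def by blast

lemma maximal_chain_iff: "maximal_chain P m \<longleftrightarrow> path P (pbot P) (ptop P) m"
proof -
  have "interval P (pbot P) (ptop P) = P"
    using bot_le le_top by (auto simp: interval_def)
  then show ?thesis using saturated_chain_iff[OF finP bot_mem top_mem, of m] bot_le top_mem by simp
qed

lemma ex_maximal_chain: "root r u \<Longrightarrow> \<exists>m. maximal_chain P m \<and> prefix r m"
  using ex_path[OF finP root_mem top_mem] path_append le_top root_mem
  unfolding maximal_chain_iff by (metis prefixI)

end

locale chain_labeled = bounded_poset P for P :: "'a::order set" +
  fixes Q :: "'q set" and R :: "'q rel" and lam :: "'a list \<times> 'a \<times> 'a \<Rightarrow> 'q"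
  assumes cel: "chain_edge_labeling P Q R lam"
begin

abbreviation "L \<equiv> label_seq P lam"

text \<open>Since labels agree along common initial segments, a chain-edge labeling amounts to one
  label for each root and each cover of its end. This is that label; the end is recovered as
  \<open>last r\<close>.\<close>

definition elab :: "'a list \<Rightarrow> 'a \<Rightarrow> 'q" where
  "elab r a = hd (L r [last r, a])"

definition lt :: "'q \<Rightarrow> 'q \<Rightarrow> bool" where
  "lt x y \<longleftrightarrow> (x, y) \<in> R \<and> x \<noteq> y"

abbreviation earlier :: "'q list \<Rightarrow> 'q list \<Rightarrow> bool" (infix \<open>\<prec>\<close> 50) where
  "s \<prec> t \<equiv> lex_earlier R s t"

lemma trans_RId: "trans (R - Id)"
  using cel unfolding chain_edge_labeling_def partial_order_on_def preorder_on_def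
  by (auto intro: trans_diff_Id)

lemma lt_trans: "lt x y \<Longrightarrow> lt y z \<Longrightarrow> lt x z"
  using trans_RId unfolding lt_def by (auto dest: transD)

lemma lt_irrefl: "\<not> lt x x"
  by (simp add: lt_def)

lemma earlier_trans: "s \<prec> t \<Longrightarrow> t \<prec> w \<Longrightarrow> s \<prec> w"
  unfolding lex_earlier_def using lexord_trans trans_RId by blast

lemma earlier_irrefl: "\<not> s \<prec> s"
  unfolding lex_earlier_def by (rule lexord_irreflexive) auto

lemma earlier_Cons: "x # s \<prec> y # t \<longleftrightarrow> lt x y \<or> x = y \<and> s \<prec> t"
  unfolding lex_earlier_def lt_def by auto

lemma earlier_Nil: "\<not> s \<prec> []"
  unfolding lex_earlier_def by simp

lemma L_single [simp]: "L r [u] = []"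
  by (simp add: label_seq_def)

lemma label_step:
  assumes "root r u" "covers P u a"
    and "maximal_chain P m" "prefix (r @ [a]) m" "maximal_chain P m'" "prefix (r @ [a]) m'"
  shows "lam (m, u, a) = lam (m', u, a)"
proof -
  have r: "r \<noteq> []" "last r = u" using assms path_last by (auto dest: path_hd)
  obtain n n' where m: "m = (r @ [a]) @ n" "m' = (r @ [a]) @ n'"
    using assms by (auto simp: prefix_def)
  \<comment> \<open>The chain \<open>r @ [a]\<close> has \<open>length r\<close> edges, and the last
    of them starts at this index.\<close>
  let ?i = "length r - 1"
  have nth: "m ! ?i = u" "m' ! ?i = u" "m ! Suc ?i = a" "m' ! Suc ?i = a"
    using r m by (simp_all add: nth_append last_conv_nth)
  have tk: "take (Suc (length r)) m = take (Suc (length r)) m'"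
    using m by simp
  have len: "length r < length m" "length r < length m'" "?i < length r" using m r by auto
  have "\<forall>c c' d. maximal_chain P c \<and> maximal_chain P c' \<and> d < length c \<and> d < length c' \<and>
        take (Suc d) c = take (Suc d) c' \<longrightarrow>
        (\<forall>i<d. lam (c, c ! i, c ! Suc i) = lam (c', c' ! i, c' ! Suc i))"
    using cel unfolding chain_edge_labeling_def by blast
  then have "lam (m, m ! ?i, m ! Suc ?i) = lam (m', m' ! ?i, m' ! Suc ?i)"
    using assms(3,5) tk len by blast
  then show ?thesis unfolding nth .
qed

text \<open>\<open>label_seq\<close> chooses a maximal chain for each sequence separately. The
  choices for the whole chain and for its first edge may differ, but \<open>label_step\<close> shows
  that this edge gets the same label from both. Inductions along chains use this recursion.\<close>

lemma L_Cons:
  assumes "root r u" "path P u v (u # a # c)"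
  shows "L r (u # a # c) = elab r a # L (r @ [a]) (a # c)"
proof -
  have ua: "covers P u a" and av: "path P a v (a # c)" using assms by auto
  have lr: "last r = u" using path_last assms by blast
  have ra: "root (r @ [a]) a" using path_snoc assms ua by blast
  let ?M = "\<lambda>p m. maximal_chain P m \<and> prefix p m"
  define m where "m = (SOME m. ?M (r @ a # c) m)"
  have "root (r @ a # c) v" using path_append[OF ra av] by simp
  then have m: "?M (r @ a # c) m"
    unfolding m_def using ex_maximal_chain by (metis (mono_tags, lifting) someI_ex)
  then have m1: "?M (r @ [a]) m" by (auto simp: prefix_def)
  define n where "n = (SOME n. ?M (r @ [a]) n)"
  have n: "?M (r @ [a]) n"
    unfolding n_def using ex_maximal_chain[OF ra] by (metis (mono_tags, lifting) someI_ex)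
  have "L r [u, a] = [lam (n, u, a)]"
    by (simp add: label_seq_def n_def Let_def)
  then have e: "elab r a = lam (m, u, a)"
    unfolding elab_def lr using label_step[OF assms(1) ua] m1 n by simp
  have "L r (u # a # c) = map (\<lambda>i. lam (m, (u # a # c) ! i, (u # a # c) ! Suc i)) [0..<Suc (length c)]"
    by (simp add: label_seq_def m_def Let_def)
  also have "\<dots> = lam (m, u, a) # map (\<lambda>i. lam (m, (a # c) ! i, (a # c) ! Suc i)) [0..<length c]"
    by (subst upt_conv_Cons) (simp_all add: map_Suc_upt[symmetric] comp_def del: upt_Suc)
  \<comment> \<open>Here the two choices coincide, because \<open>(r @ [a]) @ tl (a # c)\<close> is
    again \<open>r @ a # c\<close>.\<close>
  also have "map (\<lambda>i. lam (m, (a # c) ! i, (a # c) ! Suc i)) [0..<length c] = L (r @ [a]) (a # c)"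
    by (simp add: label_seq_def m_def Let_def)
  finally show ?thesis using e by simp
qed

lemma L_two:
  "root r u \<Longrightarrow> covers P u a \<Longrightarrow> L r [u, a] = [elab r a]"
  using L_Cons[of u r a a "[]"] by simp

lemma L_append:
  assumes "root r u" "path P u v c" "path P v w d"
  shows "L r (c @ tl d) = L r c @ L (r @ tl c) d"
  using assms
proof (induction c arbitrary: r u)
  case (Cons x c)
  show ?case
  proof (cases c)
    case Nil
    then show ?thesis using Cons path_hd by fastforce
  next
    case c: (Cons a c')
    then have x: "x = u" "covers P u a" "path P a v (a # c')" using Cons.prems by auto
    have ra: "root (r @ [a]) a" using path_snoc Cons.prems x by blast
    have "path P u w (u # a # c' @ tl d)" using path_append[OF Cons.prems(2,3)] c x by simp
    then have "L r (u # a # c' @ tl d) = elab r a # L (r @ [a]) (a # c' @ tl d)"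
      using L_Cons Cons.prems by blast
    moreover have "L (r @ [a]) (a # c' @ tl d) = L (r @ [a]) (a # c') @ L ((r @ [a]) @ c') d"
      using Cons.IH[OF ra] x c Cons.prems by simp
    moreover have "L r (u # a # c') = elab r a # L (r @ [a]) (a # c')"
      using L_Cons[of u r v a c'] Cons.prems x c by simp
    ultimately show ?thesis using c x by simp
  qed
qed auto

lemma L_length:
  "root r u \<Longrightarrow> path P u v c \<Longrightarrow> length (L r c) = length c - 1"
  by (simp add: label_seq_def Let_def)

section \<open>Lexicographically first chains and topological ascents\<close>

abbreviation "first u v r c \<equiv> lex_first P R lam u v r c"

lemma first_iff:
  assumes "rooted_interval P u v r"
  shows "first u v r c \<longleftrightarrow> path P u v c \<and> (\<forall>d. path P u v d \<and> d \<noteq> c \<longrightarrow> L r c \<prec> L r d)"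
  using sat_iff[OF assms] by (simp add: lex_first_def)

lemma first_unique: "first u v r c \<Longrightarrow> first u v r d \<Longrightarrow> c = d"
  unfolding lex_first_def using earlier_trans earlier_irrefl by blast

lemma first_refl: "root r u \<Longrightarrow> first u u r [u]"
  using first_iff[of u u r] by (auto simp: rooted_interval_iff root_mem path_same)

lemma rooted_step:
  "rooted_interval P u v r \<Longrightarrow> covers P u a \<Longrightarrow> a \<le> v \<Longrightarrow> rooted_interval P a v (r @ [a])"
  by (auto simp: rooted_interval_iff intro: path_snoc)

text \<open>All chains through \<open>a\<close> share their first label, so comparing two of them
  means comparing their tails.\<close>

lemma first_tail:
  assumes "rooted_interval P u v r" "first u v r (u # a # c)"
  shows "first a v (r @ [a]) (a # c)"
proof -
  have p: "path P u v (u # a # c)" using assms first_iff by blast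
  then have a: "covers P u a" "path P a v (a # c)" by auto
  have ra: "rooted_interval P a v (r @ [a])"
    using rooted_step assms a path_le by blast
  have "L (r @ [a]) (a # c) \<prec> L (r @ [a]) d" if d: "path P a v d" "d \<noteq> a # c" for d
  proof -
    obtain d' where d': "d = a # d'" using path_hd d by blast
    then have pd: "path P u v (u # a # d')" using d a by auto
    then have "L r (u # a # c) \<prec> L r (u # a # d')"
      using assms first_iff d d' by blast
    then show ?thesis
      using L_Cons p pd assms d' by (auto simp: rooted_interval_iff earlier_Cons lt_irrefl)
  qed
  then show ?thesis using first_iff[OF ra] a by blast
qed

lemma topological_ascent_iff:
  "topological_ascent P R lam r u a w \<longleftrightarrow>
     covers P u a \<and> covers P a w \<and> first u w r [u, a, w]" if "root r u"
proof (cases "covers P u a \<and> covers P a w")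
  case True
  then have "u \<le> w" "w \<in> P" by (auto dest!: coversD)
  then have "rooted_interval P u w r" using that by (simp add: rooted_interval_iff)
  then show ?thesis using True
    by (auto simp: topological_ascent_def first_iff sat_iff)
qed (auto simp: topological_ascent_def)

lemma ata_single: "all_topological_ascents P R lam r [u]" "all_topological_ascents P R lam r [u, a]"
  by (auto simp: all_topological_ascents_def)

lemma ata_Cons:
  "all_topological_ascents P R lam r (u # a # b # c) \<longleftrightarrow>
     topological_ascent P R lam r u a b \<and> all_topological_ascents P R lam (r @ [a]) (a # b # c)"
  unfolding all_topological_ascents_def
proof (safe, goal_cases)
  case 1
  then show ?case by (auto dest: spec[of _ 0])
next
  case (2 i)
  then show ?case by (auto dest: spec[of _ "Suc i"])
next
  case (3 i)
  then show ?case by (cases i) (auto simp: numeral_2_eq_2)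
qed

lemma has_descent_iff:
  assumes "path P u v c"
  shows "has_topological_descent P R lam r c \<longleftrightarrow> \<not> all_topological_ascents P R lam r c"
proof -
  have "covers P (c ! i) (c ! Suc i)" if "Suc i < length c" for i
    using assms that
  proof (induction P u v c arbitrary: i rule: path.induct)
    case (3 S u v x y c)
    then show ?case by (cases i) auto
  qed auto
  then show ?thesis
    unfolding has_topological_descent_def all_topological_ascents_def topological_descent_def
    by (auto simp: numeral_2_eq_2)
qed

text \<open>If the first chain \<open>e\<close> of [u, b] were not \<open>[u, a, b]\<close>,
  replacing the initial piece by \<open>e\<close> would give an earlier chain of [u, v]. The
  hypothesis \<open>ex\<close> supplies \<open>e\<close>: failure of an ascent alone would not
  produce an earlier chain.\<close>

lemma first_topological_ascent:
  assumes ex: "\<And>u v r. rooted_interval P u v r \<Longrightarrow> \<exists>c. first u v r c"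
    and ri: "rooted_interval P u v r" and f: "first u v r (u # a # b # c)"
  shows "topological_ascent P R lam r u a b"
proof -
  have p: "path P u v (u # a # b # c)" using f first_iff[OF ri] by blast
  then have a: "covers P u a" "covers P a b" "path P b v (b # c)" by auto
  have r: "root r u" using ri by (simp add: rooted_interval_iff)
  have "u \<le> b" "b \<in> P" using a by (auto dest!: coversD)
  then have rb: "rooted_interval P u b r" using r by (simp add: rooted_interval_iff)
  then obtain e where e: "first u b r e" using ex[OF rb] by blast
  have pu: "path P u b [u, a, b]" using a by auto
  have pe: "path P u b e" using first_iff[OF rb] e by blast
  have "e = [u, a, b]"
  proof (rule ccontr)
    assume ne: "e \<noteq> [u, a, b]"
    then have early: "L r e \<prec> L r [u, a, b]" using e first_iff[OF rb, of e] pu by blast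
    have "u \<noteq> b" using a by (auto dest!: coversD)
    then obtain x e' where e': "e = u # x # e'" "covers P u x" "path P x b (x # e')"
      using pe path_neqE by blast
    \<comment> \<open>\<open>b\<close> does not cover \<open>u\<close>, because \<open>a\<close>
      lies strictly between. Hence \<open>e\<close> has at least two edges.\<close>
    have "x \<noteq> b"
      using a e' by (auto simp: covers_def)
    then obtain y e'' where e'': "e' = y # e''"
      using path_neqE[OF e'(3) \<open>x \<noteq> b\<close>] by blast
    have len: "length (L r [u, a, b]) = 2" "length (L r e) \<ge> 2"
      using L_length[OF r] pu pe e' e'' by auto
    \<comment> \<open>Appending can destroy a comparison decided by a proper prefix. This cannot
      happen here: \<open>L r e\<close> has at least two labels and \<open>L r [u, a, b]\<close>
      exactly two, so the first two labels decide.\<close>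
    have "L r e @ s \<prec> L r [u, a, b] @ t" for s t
    proof -
      obtain k l where kl: "L r [u, a, b] = [k, l]"
        using len(1) by (auto simp: numeral_2_eq_2 length_Suc_conv)
      obtain k' l' z where kl': "L r e = k' # l' # z"
        using len(2) by (cases "L r e"; cases "tl (L r e)") auto
      show ?thesis using early unfolding kl kl' by (auto simp: earlier_Cons earlier_Nil)
    qed
    moreover have "L r (e @ c) = L r e @ L (r @ tl e) (b # c)"
      using L_append[OF r pe a(3)] by simp
    moreover have "L r (u # a # b # c) = L r [u, a, b] @ L (r @ [a, b]) (b # c)"
      using L_append[OF r pu a(3)] by simp
    ultimately have *: "L r (e @ c) \<prec> L r (u # a # b # c)" by simp
    have "path P u v (e @ c)" using path_append[OF pe a(3)] by simp
    then have "e @ c = u # a # b # c \<or> L r (u # a # b # c) \<prec> L r (e @ c)"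
      using f first_iff[OF ri, of "u # a # b # c"] by blast
    then show False using * earlier_trans[OF *] earlier_irrefl by auto
  qed
  then show ?thesis using e a topological_ascent_iff[OF r, of a b] by simp
qed

lemma first_all_topological_ascents:
  assumes ex: "\<And>u v r. rooted_interval P u v r \<Longrightarrow> \<exists>c. first u v r c"
    and "rooted_interval P u v r" "first u v r c"
  shows "all_topological_ascents P R lam r c"
  using assms(2,3)
proof (induction c arbitrary: u r)
  case (Cons x c)
  then have p: "path P u v (x # c)" using first_iff by blast
  show ?case
  proof (cases c)
    case Nil
    then show ?thesis by (simp add: ata_single)
  next
    case c: (Cons a c')
    show ?thesis
    proof (cases c')
      case Nil
      then show ?thesis using c by (simp add: ata_single)
    next
      case c': (Cons b c'')
      have x: "x = u" "covers P u a" "path P a v c" using p c by auto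
      have "topological_ascent P R lam r u a b"
        using first_topological_ascent[OF ex Cons.prems(1)] Cons.prems(2) x c c' by simp
      moreover have "all_topological_ascents P R lam (r @ [a]) c"
        using Cons.IH[of a "r @ [a]"] first_tail[of u v r a c'] Cons.prems x c rooted_step path_le
        by blast
      ultimately show ?thesis using c c' x by (simp add: ata_Cons)
    qed
  qed
qed (auto simp: all_topological_ascents_def)

text \<open>Two first chains would each be earlier than the other, so uniqueness is automatic; and a
  chain without topological descents consists of topological ascents.\<close>

lemma lex_first_exists_TCL:
  assumes "\<And>u v r. rooted_interval P u v r \<Longrightarrow> \<exists>c. first u v r c"
    and "\<And>u v r c. rooted_interval P u v r \<Longrightarrow> path P u v c \<Longrightarrow>
      all_topological_ascents P R lam r c \<Longrightarrow> first u v r c"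
  shows "TCL_labeling P Q R lam"
proof -
  have "(\<exists>!c. first u v r c) \<and>
    (\<forall>d. saturated_chain P u v d \<and> \<not> first u v r d \<longrightarrow> has_topological_descent P R lam r d)"
    if ri: "rooted_interval P u v r" for u v r
  proof (intro conjI allI impI)
    obtain c where c: "first u v r c" using assms(1)[OF ri] by blast
    show "\<exists>!c. first u v r c" using c first_unique[OF _ c] by (intro ex1I)
    fix d assume "saturated_chain P u v d \<and> \<not> first u v r d"
    then have d: "path P u v d" "\<not> first u v r d" using sat_iff[OF ri, of d] by simp_all
    then have "\<not> all_topological_ascents P R lam r d" using assms(2)[OF ri d(1)] by blast
    then show "has_topological_descent P R lam r d" using has_descent_iff[OF d(1), of r] by blast
  qed
  then show ?thesis using cel unfolding TCL_labeling_def by blast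
qed

text \<open>A first chain consists of topological ascents, hence is the only such chain. Its
  existence is a separate hypothesis, as a CC-labeling only demands distinct label sequences, which
  may be incomparable.\<close>

lemma CC_TCL:
  assumes CC: "CC_labeling P Q R lam"
    and ex: "\<And>u v r. rooted_interval P u v r \<Longrightarrow> \<exists>c. first u v r c"
  shows "TCL_labeling P Q R lam"
proof (rule lex_first_exists_TCL[OF ex])
  fix u v r c
  assume ri: "rooted_interval P u v r"
    and c: "path P u v c" "all_topological_ascents P R lam r c"
  obtain d where d: "first u v r d" using ex[OF ri] by blast
  then have "path P u v d" using first_iff[OF ri] by blast
  moreover have "all_topological_ascents P R lam r d"
    by (rule first_all_topological_ascents[OF ex ri d])
  moreover have "\<exists>!c. path P u v c \<and> all_topological_ascents P R lam r c"
    using CC ri unfolding CC_labeling_def sat_iff[OF ri, symmetric] by blast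
  ultimately have "c = d" using c by blast
  then show "first u v r c" using d by simp
qed

section \<open>The UE property and self-consistency\<close>

lemma atoms_rooted:
  assumes "rooted_interval P u v r"
  shows "atoms (interval P u v) = {a. covers P u a \<and> a \<le> v}"
  using assms by (auto simp: rooted_interval_def atoms_interval)

text \<open>The minimal label is traded for the atom that carries it, and the comparison becomes
  strict. Returning to the non-strict form needs reflexivity of \<open>R\<close>, available only on
  \<open>Q\<close>; so the label has to be recognized as the label of an actual chain edge.\<close>

lemma UE_iff:
  "UE_property P R lam \<longleftrightarrow>
     (\<forall>u v r. rooted_interval P u v r \<and> u < v \<longrightarrow>
       (\<exists>a. covers P u a \<and> a \<le> v \<and>
          (\<forall>b. covers P u b \<and> b \<le> v \<and> b \<noteq> a \<longrightarrow> lt (elab r a) (elab r b))))"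
proof -
  have eq: "(\<exists>l. (\<forall>a \<in> atoms (interval P u v). (l, hd (L r [u, a])) \<in> R) \<and>
             (\<exists>!a. a \<in> atoms (interval P u v) \<and> hd (L r [u, a]) = l)) \<longleftrightarrow>
       (\<exists>a. covers P u a \<and> a \<le> v \<and>
          (\<forall>b. covers P u b \<and> b \<le> v \<and> b \<noteq> a \<longrightarrow> lt (elab r a) (elab r b)))"
    (is "?l \<longleftrightarrow> ?r") if ri: "rooted_interval P u v r" for u v r
  proof -
    have r: "root r u" using ri by (simp add: rooted_interval_iff)
    have e: "hd (L r [u, a]) = elab r a" for a
      using path_last[OF r] by (simp add: elab_def)
    have refl: "(elab r a, elab r a) \<in> R" if a: "covers P u a" for a
    proof -
      have "root (r @ [a]) a" using path_snoc r a by blast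
      then obtain m where m: "maximal_chain P m" "prefix (r @ [a]) m"
        using ex_maximal_chain by blast
      then obtain n where n: "m = r @ a # n" by (auto simp: prefix_def)
      define m' where "m' = (SOME m. maximal_chain P m \<and> prefix (r @ [a]) m)"
      have m': "maximal_chain P m'" "prefix (r @ [a]) m'"
        unfolding m'_def using m by (metis (mono_tags, lifting) someI)+
      have eq: "elab r a = lam (m', u, a)"
        unfolding e[symmetric] by (simp add: label_seq_def m'_def Let_def)
      have "u \<in> set r" using path_last[OF r] path_hd[OF r] last_in_set by blast
      then have "(m', u, a) \<in> chain_edges P"
        using m' a by (auto simp: chain_edges_def prefix_def)
      then show ?thesis using cel eq
        by (simp add: chain_edge_labeling_def partial_order_on_def preorder_on_def refl_on_def)
    qed
    show ?thesis
      unfolding atoms_rooted[OF ri] e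
    proof
      assume ?r
      then obtain a where a: "covers P u a" "a \<le> v"
        "\<And>b. covers P u b \<Longrightarrow> b \<le> v \<Longrightarrow> b \<noteq> a \<Longrightarrow> lt (elab r a) (elab r b)" by blast
      show "\<exists>l. (\<forall>a\<in>{a. covers P u a \<and> a \<le> v}. (l, elab r a) \<in> R) \<and>
             (\<exists>!a. a \<in> {a. covers P u a \<and> a \<le> v} \<and> elab r a = l)"
      proof (intro exI[of _ "elab r a"] conjI ballI)
        fix b assume "b \<in> {a. covers P u a \<and> a \<le> v}"
        then show "(elab r a, elab r b) \<in> R" using a refl by (cases "b = a") (auto simp: lt_def)
      next
        show "\<exists>!b. b \<in> {a. covers P u a \<and> a \<le> v} \<and> elab r b = elab r a"
          using a by (auto simp: lt_def) metis
      qed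
    qed (force simp: lt_def)
  qed
  show ?thesis
    unfolding UE_property_def by (intro iff_allI imp_cong refl, rule eq, blast)
qed

text \<open>Self-consistency speaks of chains that contain an atom, the recursion for labels of
  chains that begin with it.\<close>

lemma chain_head:
  assumes "path P u v c" "covers P u a" "a \<in> set c"
  shows "\<exists>c'. c = u # a # c'"
  using assms
proof (cases "(P, u, v, c)" rule: path.cases)
  case (3 S u' v' x y c')
  then have y: "covers P u y" "path P y v (y # c')" "x = u" using assms by auto
  then have "y \<le> a" using path_set[OF y(2)] 3 assms by (auto dest: coversD)
  then have "y = a" using y assms by (auto simp: covers_def less_le)
  then show ?thesis using 3 y by simp
qed (auto dest: coversD)

text \<open>Greedy construction: take the atom with the strictly smallest label and continue with a
  first chain above it. Chains through other atoms lose at the first label, chains through the same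
  atom lose in the tail.\<close>

lemma UE_first:
  assumes UE: "UE_property P R lam" and ri: "rooted_interval P u v r"
  shows "\<exists>c. first u v r c"
  using ri
proof (induction u arbitrary: r rule: cover_induct[OF finP])
  case (1 u)
  show ?case
  proof (cases "u = v")
    case True
    then show ?thesis using first_refl 1 by (auto simp: rooted_interval_iff)
  next
    case False
    then have "u < v" using 1 by (auto simp: rooted_interval_iff less_le)
    then obtain a where a: "covers P u a" "a \<le> v"
      "\<And>b. covers P u b \<Longrightarrow> b \<le> v \<Longrightarrow> b \<noteq> a \<Longrightarrow> lt (elab r a) (elab r b)"
      using UE 1 unfolding UE_iff by blast
    have ra: "rooted_interval P a v (r @ [a])" using rooted_step 1 a by blast
    then obtain c where c: "first a v (r @ [a]) c" using 1 a by blast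
    then have pc: "path P a v c" using first_iff[OF ra] by blast
    then obtain c' where c': "c = a # c'" using path_hd by blast
    have p: "path P u v (u # a # c')" using pc c' a by simp
    have r: "root r u" using 1 by (simp add: rooted_interval_iff)
    have "L r (u # a # c') \<prec> L r d" if d: "path P u v d" "d \<noteq> u # a # c'" for d
    proof -
      obtain b d' where b: "d = u # b # d'" "covers P u b" "path P b v (b # d')"
        using path_neqE[OF d(1) False] by blast
      show ?thesis
      proof (cases "b = a")
        case True
        then have "L (r @ [a]) c \<prec> L (r @ [a]) (a # d')"
          using c b d c' first_iff[OF ra] by auto
        then show ?thesis using L_Cons[OF r] p d b True c' by (auto simp: earlier_Cons)
      next
        case False
        then show ?thesis using L_Cons[OF r] p d b a(3)[of b] path_le[OF b(3)] by (auto simp: earlier_Cons)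
      qed
    qed
    then show ?thesis using first_iff 1 p by blast
  qed
qed

lemma UE_self_consistent:
  assumes UE: "UE_property P R lam"
  shows "self_consistent P R lam"
  unfolding self_consistent_def
proof (intro conjI allI impI)
  fix u v r assume "rooted_interval P u v r"
  then show "\<exists>!c. first u v r c" using UE_first[OF UE] first_unique by blast
next
  fix u v r c a b v' ca cb
  assume *: "rooted_interval P u v r \<and> first u v r c \<and>
        a \<in> atoms (interval P u v) \<and> a \<in> set c \<and>
        b \<in> atoms (interval P u v) \<and> b \<noteq> a"
    and **: "rooted_interval P u v' r \<and> a \<in> interval P u v' \<and> b \<in> interval P u v'"
    and ***: "saturated_chain P u v' ca \<and> a \<in> set ca \<and> saturated_chain P u v' cb \<and> b \<in> set cb"
  have r: "root r u" using * by (simp add: rooted_interval_iff)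
  have ab: "covers P u a" "covers P u b" "a \<le> v" "b \<le> v" using * atoms_rooted by auto
  have pc: "path P u v c" using * first_iff by blast
  then obtain c' where c: "c = u # a # c'" using * ab chain_head by blast
  have "u < v" using ab by (auto dest: coversD)
  then obtain m where m: "covers P u m" "m \<le> v"
    "\<And>b. covers P u b \<Longrightarrow> b \<le> v \<Longrightarrow> b \<noteq> m \<Longrightarrow> lt (elab r m) (elab r b)"
    using UE * unfolding UE_iff by blast
  \<comment> \<open>A chain through \<open>m\<close> would start with a smaller label than the first
    chain. So \<open>a\<close> carries the strictly smallest label, and this first label decides
    every comparison, whatever the upper end \<open>v'\<close>.\<close>
  have "m = a"
  proof (rule ccontr)
    assume ne: "m \<noteq> a"
    obtain d where d: "path P m v d" using ex_path[OF finP] m pc path_mem_last ab * coversD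
      by (metis rooted_interval_def)
    then obtain d' where d': "d = m # d'" using path_hd by blast
    then have p: "path P u v (u # m # d')" using d m by simp
    then have "L r c \<prec> L r (u # m # d')" using * c ne first_iff by blast
    then have "lt (elab r a) (elab r m) \<or> elab r a = elab r m"
      using L_Cons[OF r] p pc c by (auto simp: earlier_Cons)
    moreover have "lt (elab r m) (elab r a)" using m ab ne by blast
    ultimately show False using lt_trans lt_irrefl by metis
  qed
  then have lt: "lt (elab r a) (elab r b)" using m ab * by blast
  have pp: "path P u v' ca" "path P u v' cb" using ** *** sat_iff by blast+
  then obtain ca' cb' where "ca = u # a # ca'" "cb = u # b # cb'"
    using *** ab chain_head by blast
  then show "L r ca \<prec> L r cb" using pp L_Cons[OF r] lt by (auto simp: earlier_Cons)
qed

section \<open>Ascending chains and CL-labelings\<close>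

lemma ascending_single: "ascending P R lam r [u]"
  by (simp add: ascending_def)

lemma ascending_two: "root r u \<Longrightarrow> covers P u a \<Longrightarrow> ascending P R lam r [u, a]"
  by (simp add: ascending_def L_two)

lemma ascending_Cons:
  assumes "root r u" "path P u v (u # a # b # c)"
  shows "ascending P R lam r (u # a # b # c) \<longleftrightarrow>
    lt (elab r a) (elab (r @ [a]) b) \<and> ascending P R lam (r @ [a]) (a # b # c)"
proof -
  have a: "covers P u a" "path P a v (a # b # c)" using assms by auto
  then have ra: "root (r @ [a]) a" using path_snoc assms by blast
  then show ?thesis
    using L_Cons[OF assms] L_Cons[OF ra a(2)] by (simp add: ascending_def lt_def)
qed

context
  assumes CL: "CL_labeling P Q R lam"
begin

lemma CL_first: "rooted_interval P u v r \<Longrightarrow> \<exists>c. first u v r c \<and> ascending P R lam r c"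
  using CL unfolding CL_labeling_def by blast

lemma CL_ascending_first:
  "rooted_interval P u v r \<Longrightarrow> path P u v c \<Longrightarrow> ascending P R lam r c \<Longrightarrow> first u v r c"
  using CL sat_iff unfolding CL_labeling_def by blast

text \<open>The ascending chain of [u, b] is its first chain, and so is \<open>[u, a, b]\<close>;
  they coincide.\<close>

lemma CL_topological_ascent:
  assumes "root r u" "topological_ascent P R lam r u a b"
  shows "lt (elab r a) (elab (r @ [a]) b)"
proof -
  have a: "covers P u a" "covers P a b" "first u b r [u, a, b]"
    using assms topological_ascent_iff by auto
  then have "rooted_interval P u b r"
    using assms by (auto simp: rooted_interval_iff dest!: coversD)
  then have "ascending P R lam r [u, a, b]" using CL_first a first_unique by metis
  then show ?thesis using ascending_Cons[OF assms(1), of b a b "[]"] a by simp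
qed

lemma CL_all_topological_ascents:
  assumes "root r u" "path P u v c" "all_topological_ascents P R lam r c"
  shows "ascending P R lam r c"
  using assms
proof (induction c arbitrary: r u)
  case (Cons x c)
  show ?case
  proof (cases c)
    case Nil
    then show ?thesis by (simp add: ascending_single)
  next
    case c: (Cons a c')
    then have x: "x = u" "covers P u a" "path P a v c" using Cons.prems by auto
    show ?thesis
    proof (cases c')
      case Nil
      then show ?thesis using c x ascending_two Cons.prems by blast
    next
      case c': (Cons b c'')
      have ra: "root (r @ [a]) a" using path_snoc Cons.prems x by blast
      have "topological_ascent P R lam r u a b" "all_topological_ascents P R lam (r @ [a]) c"
        using Cons.prems c c' x by (auto simp: ata_Cons)
      then show ?thesis using Cons.IH[OF ra] x c c' Cons.prems CL_topological_ascent
        ascending_Cons[of u r v a b c''] by blast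
    qed
  qed
qed (auto simp: ascending_def)

lemma CL_TCL: "TCL_labeling P Q R lam"
proof (rule lex_first_exists_TCL)
  fix u v r c assume ri: "rooted_interval P u v r"
  show "\<exists>c. first u v r c" using CL_first ri by blast
  assume "path P u v c" "all_topological_ascents P R lam r c"
  then show "first u v r c"
    using CL_ascending_first[OF ri] CL_all_topological_ascents ri rooted_interval_iff by blast
qed

text \<open>If an atom \<open>b\<close> shared the first label of the ascending chain, then the lexicographically first
  chain through \<open>b\<close> would be a second ascending chain.\<close>

lemma CL_UE: "UE_property P R lam"
  unfolding UE_iff
proof (intro allI impI)
  fix u v r assume *: "rooted_interval P u v r \<and> u < v"
  then have ri: "rooted_interval P u v r" and r: "root r u" by (auto simp: rooted_interval_iff)
  obtain c where c: "first u v r c" "ascending P R lam r c" using CL_first ri by blast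
  then have pc: "path P u v c" using first_iff ri by blast
  then obtain a c' where a: "c = u # a # c'" "covers P u a" "path P a v (a # c')"
    using path_neqE * by (metis less_irrefl)
  show "\<exists>a. covers P u a \<and> a \<le> v \<and>
          (\<forall>b. covers P u b \<and> b \<le> v \<and> b \<noteq> a \<longrightarrow> lt (elab r a) (elab r b))"
  proof (intro exI conjI allI impI)
    show "covers P u a" "a \<le> v" using a path_le by auto
    fix b assume b: "covers P u b \<and> b \<le> v \<and> b \<noteq> a"
    have rb: "rooted_interval P b v (r @ [b])" using rooted_step ri b by blast
    then obtain d where d: "first b v (r @ [b]) d" "ascending P R lam (r @ [b]) d"
      using CL_first by blast
    then have pd: "path P b v d" using first_iff rb by blast
    \<comment> \<open>If one of the two were \<open>v\<close>, the other would lie strictly between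
      it and \<open>u\<close>. So both chains have a second edge.\<close>
    have "a \<noteq> v" "b \<noteq> v" using a b path_le[OF a(3)] by (auto simp: covers_def less_le)
    then obtain x c'' where x: "c' = x # c''" "covers P a x" "path P x v (x # c'')"
      using path_neqE[OF a(3)] by blast
    obtain y d' where y: "d = b # y # d'" "covers P b y" "path P y v (y # d')"
      using path_neqE[OF pd \<open>b \<noteq> v\<close>] by blast
    have pu: "path P u v (u # b # y # d')" using b y by auto
    have ne: "u # b # y # d' \<noteq> c" using a b by auto
    then have "L r c \<prec> L r (u # b # y # d')" using c first_iff[OF ri] pu by blast
    moreover have "L r c = elab r a # L (r @ [a]) (a # x # c'')"
      using L_Cons[OF r] pc a x by simp
    moreover have "L (r @ [a]) (a # x # c'') = elab (r @ [a]) x # L ((r @ [a]) @ [x]) (x # c'')"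
      using L_Cons[OF path_snoc[OF r a(2)]] a x by simp
    moreover have "L r (u # b # y # d') = elab r b # L (r @ [b]) (b # y # d')"
      using L_Cons[OF r pu] .
    moreover have "L (r @ [b]) (b # y # d') = elab (r @ [b]) y # L ((r @ [b]) @ [y]) (y # d')"
      using L_Cons[OF path_snoc[OF r]] b y pd by simp
    ultimately have or: "lt (elab r a) (elab r b) \<or> elab r a = elab r b \<and>
      (lt (elab (r @ [a]) x) (elab (r @ [b]) y) \<or> elab (r @ [a]) x = elab (r @ [b]) y)"
      by (auto simp: earlier_Cons)
    have "lt (elab r a) (elab (r @ [a]) x)"
      using c(2) ascending_Cons[OF r] pc a x by simp
    moreover have "\<not> lt (elab r b) (elab (r @ [b]) y)"
    proof
      assume "lt (elab r b) (elab (r @ [b]) y)"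
      then have "ascending P R lam r (u # b # y # d')"
        using ascending_Cons[OF r pu] d y by simp
      then show False using CL_ascending_first[OF ri pu] c(1) first_unique ne by blast
    qed
    \<comment> \<open>With equal first labels, the label of \<open>b\<close> would be that of
      \<open>a\<close>, hence below the label of \<open>x\<close>, which is below or equal to the
      label of \<open>y\<close>. This is the ascent just excluded.\<close>
    ultimately show "lt (elab r a) (elab r b)" using or lt_trans by metis
  qed
qed

text \<open>Condition (2) of a CC-labeling is not part of a CL-labeling; injectivity on the covers
  above a common root supplies it. Two distinct chains of an interval separate at some element, and
  there their labels differ.\<close>

lemma CL_CC:
  assumes inj: "\<And>u r a b. root r u \<Longrightarrow> covers P u a \<Longrightarrow> covers P u b \<Longrightarrow>
    elab r a = elab r b \<Longrightarrow> a = b"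
  shows "CC_labeling P Q R lam"
  unfolding CC_labeling_def
proof (intro conjI allI impI)
  fix u v r assume ri: "rooted_interval P u v r"
  obtain c where c: "first u v r c" using CL_first ri by blast
  have "path P u v c" using c first_iff[OF ri] by blast
  moreover have "all_topological_ascents P R lam r c"
    using first_all_topological_ascents[OF _ ri c] CL_first by blast
  moreover have "d = c" if "path P u v d" "all_topological_ascents P R lam r d" for d
    using that CL_all_topological_ascents CL_ascending_first[OF ri] ri c first_unique
    by (metis rooted_interval_iff)
  ultimately show "\<exists>!c. saturated_chain P u v c \<and> all_topological_ascents P R lam r c"
    using sat_iff[OF ri] by blast
next
  have np: "\<not> prefix (L r c) (L r d)"
    if "root r u" "path P u v c" "path P u v d" "c \<noteq> d" for u v r c d
    using that
  proof (induction u arbitrary: r c d rule: cover_induct[OF finP])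
    case (1 u)
    then have "u \<noteq> v" by (auto simp: path_same)
    then obtain a c' b d' where c: "c = u # a # c'" "covers P u a" "path P a v (a # c')"
      and d: "d = u # b # d'" "covers P u b" "path P b v (b # d')"
      using path_neqE 1 by metis
    have *: "L r c = elab r a # L (r @ [a]) (a # c')" "L r d = elab r b # L (r @ [b]) (b # d')"
      using L_Cons 1 c d by auto
    show ?case
    proof (cases "a = b")
      case True
      have "root (r @ [a]) a" using path_snoc 1 c by blast
      then have "\<not> prefix (L (r @ [a]) (a # c')) (L (r @ [a]) (b # d'))"
        using 1(1)[of a "r @ [a]" "a # c'" "b # d'"] c d 1 True by blast
      then show ?thesis using * True by simp
    next
      case False
      then show ?thesis using inj * 1 c d by auto
    qed
  qed
  fix u v r c d
  assume ri: "rooted_interval P u v r"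
    and cd: "saturated_chain P u v c \<and> saturated_chain P u v d \<and> c \<noteq> d"
  then show "\<not> prefix (L r c) (L r d)"
    using np sat_iff rooted_interval_iff by blast
  then show "L r c \<noteq> L r d" by auto
qed (rule cel)

end

end

section \<open>Recursive atom orderings in terms of precedence\<close>

text \<open>Unlike positions, precedence behaves simply under filtering and concatenation, the
  operations by which orderings are restricted and rearranged.\<close>

fun before :: "'b list \<Rightarrow> 'b \<Rightarrow> 'b \<Rightarrow> bool" where
  "before [] a b \<longleftrightarrow> False"
| "before (x # xs) a b \<longleftrightarrow> x = a \<and> b \<in> set xs \<or> before xs a b"

lemma before_mem: "before xs a b \<Longrightarrow> a \<in> set xs \<and> b \<in> set xs"
  by (induction xs) auto

lemma before_append:
  "before (xs @ ys) a b \<longleftrightarrow> before xs a b \<or> before ys a b \<or> a \<in> set xs \<and> b \<in> set ys"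
  by (induction xs) auto

lemma before_filter: "before (filter Q xs) a b \<longleftrightarrow> Q a \<and> Q b \<and> before xs a b"
  by (induction xs) auto

lemma before_total: "a \<in> set xs \<Longrightarrow> b \<in> set xs \<Longrightarrow> a \<noteq> b \<Longrightarrow> before xs a b \<or> before xs b a"
  by (induction xs) auto

lemma before_irrefl: "distinct xs \<Longrightarrow> \<not> before xs a a"
  by (induction xs) auto

lemma before_trans: "distinct xs \<Longrightarrow> before xs a b \<Longrightarrow> before xs b c \<Longrightarrow> before xs a c"
  by (induction xs) (auto dest: before_mem)

lemma before_nth:
  "distinct xs \<Longrightarrow> j < length xs \<Longrightarrow> before xs a (xs ! j) \<longleftrightarrow> (\<exists>i<j. xs ! i = a)"
proof (induction xs arbitrary: j)
  case (Cons x xs)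
  show ?case
  proof (cases j)
    case 0
    then show ?thesis using Cons before_mem[of xs a x] by auto
  next
    case (Suc k)
    then have "before (x # xs) a ((x # xs) ! j) \<longleftrightarrow> x = a \<or> before xs a (xs ! k)"
      using Cons.prems by auto
    also have "\<dots> \<longleftrightarrow> x = a \<or> (\<exists>i<k. xs ! i = a)"
      using Cons Suc by auto
    also have "\<dots> \<longleftrightarrow> (\<exists>i<j. (x # xs) ! i = a)"
      unfolding Suc Ex_less_Suc2 by simp
    finally show ?thesis .
  qed
qed simp

text \<open>Conditions (i)(b) and (ii) depend on the predecessors of \<open>a\<close> only through
  this predicate. An ordering may thus be changed freely as long as \<open>early\<close> is
  preserved.\<close>

definition early :: "'a::order list \<Rightarrow> 'a \<Rightarrow> 'a \<Rightarrow> bool" where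
  "early as a x \<longleftrightarrow> (\<exists>k. before as k a \<and> k < x)"

lemma early_nth:
  assumes "distinct as" "j < length as"
  shows "early as (as ! j) x \<longleftrightarrow> (\<exists>k<j. as ! k < x)"
  using before_nth[OF assms] by (auto simp: early_def)

lemma hd_filter_before:
  assumes "distinct xs" "a \<in> set xs" "Q a"
  shows "hd (filter Q xs) \<in> set xs" "Q (hd (filter Q xs))"
    "a = hd (filter Q xs) \<or> before xs (hd (filter Q xs)) a"
  using assms by (induction xs) auto

lemma early_condition_iff:
  assumes "distinct as"
  shows "(\<forall>i j y. i < j \<and> j < length as \<and> y \<in> S \<and> as ! i < y \<and> as ! j < y \<longrightarrow>
        (\<exists>k<j. \<exists>z\<in>S. covers S (as ! j) z \<and> as ! k < z \<and> z \<le> y)) \<longleftrightarrow>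
    (\<forall>a y. a \<in> set as \<and> y \<in> S \<and> a < y \<and> early as a y \<longrightarrow>
        (\<exists>z. covers S a z \<and> early as a z \<and> z \<le> y))" (is "?l \<longleftrightarrow> ?r")
proof
  assume l: ?l
  show ?r
  proof (intro allI impI)
    fix a y assume *: "a \<in> set as \<and> y \<in> S \<and> a < y \<and> early as a y"
    then obtain j where j: "j < length as" "a = as ! j" by (metis in_set_conv_nth)
    then obtain i where "i < j" "as ! i < y" using * early_nth[OF assms] by blast
    then obtain k z where "k < j" "covers S a z" "as ! k < z" "z \<le> y" using l * j by blast
    then show "\<exists>z. covers S a z \<and> early as a z \<and> z \<le> y"
      using j early_nth[OF assms] by blast
  qed
next
  assume r: ?r
  show ?l
  proof (intro allI impI)
    fix i j y assume *: "i < j \<and> j < length as \<and> y \<in> S \<and> as ! i < y \<and> as ! j < y"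
    then have "early as (as ! j) y" using early_nth[OF assms] by blast
    then obtain z where "covers S (as ! j) z" "early as (as ! j) z" "z \<le> y"
      using r * nth_mem by blast
    then show "\<exists>k<j. \<exists>z\<in>S. covers S (as ! j) z \<and> as ! k < z \<and> z \<le> y"
      using * early_nth[OF assms] coversD by blast
  qed
qed

section \<open>Posets of length one and intervals above an atom\<close>

lemma chain_length_le_card: "finite S \<Longrightarrow> chain_in S c \<Longrightarrow> length c \<le> card S"
proof -
  assume S: "finite S" "chain_in S c"
  have "sorted_wrt (<) c \<Longrightarrow> distinct c" by (induction c) auto
  then have "distinct c" using S by (simp add: chain_in_def)
  then show ?thesis using S by (metis card_mono chain_in_def distinct_card)
qed

lemma le_poset_length:
  assumes "finite S" "chain_in S c" "c \<noteq> []"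
  shows "length c - 1 \<le> poset_length S"
proof -
  have "{length c - 1 | c. chain_in S c \<and> c \<noteq> []} \<subseteq> {..card S}"
    using chain_length_le_card[OF assms(1)] by fastforce
  then have "finite {length c - 1 | c. chain_in S c \<and> c \<noteq> []}"
    using finite_subset by blast
  then show ?thesis unfolding poset_length_def using assms by (intro Max_ge) auto
qed

lemma poset_length_le:
  assumes "finite S" "S \<noteq> {}"
  shows "poset_length S \<le> card S - 1"
proof -
  have sub: "{length c - 1 | c. chain_in S c \<and> c \<noteq> []} \<subseteq> {..card S - 1}"
    using chain_length_le_card[OF assms(1)] by fastforce
  obtain x where "x \<in> S" using assms by blast
  then have "chain_in S [x]" by (simp add: chain_in_def)
  then have "{length c - 1 | c. chain_in S c \<and> c \<noteq> []} \<noteq> {}" by blast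
  then show ?thesis unfolding poset_length_def using sub finite_subset[OF sub]
    by (metis (no_types, lifting) Max_in atMost_iff finite_atMost subsetD)
qed

context
  fixes S :: "'a::order set"
  assumes fbp: "finite_bounded_poset S"
begin

text \<open>Explicit chains of two or three elements bound the length from below. The upper bound
  \<open>card S - 1\<close> is sharp enough, as it is used only when \<open>S\<close> has at most
  two elements.\<close>

lemma poset_length_one_iff: "poset_length S = 1 \<longleftrightarrow> covers S (pbot S) (ptop S)"
  and poset_length_pos_iff: "poset_length S \<ge> 1 \<longleftrightarrow> pbot S \<noteq> ptop S"
proof -
  note D = finite_bounded_posetD[OF fbp]
  have one: "poset_length S \<ge> 1" if "pbot S \<noteq> ptop S"
  proof -
    have "chain_in S [pbot S, ptop S]" using D that by (auto simp: chain_in_def less_le)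
    then show ?thesis using le_poset_length[OF D(1)] by fastforce
  qed
  have two: "poset_length S \<ge> 2" if ne: "pbot S \<noteq> ptop S" and nc: "\<not> covers S (pbot S) (ptop S)"
  proof -
    have "pbot S < ptop S" using D ne by (simp add: less_le)
    then obtain z where "z \<in> S" "pbot S < z" "z < ptop S"
      using D(2,3) nc unfolding covers_def by blast
    then have "chain_in S [pbot S, z, ptop S]" using D by (auto simp: chain_in_def)
    then show ?thesis using le_poset_length[OF D(1)] by fastforce
  qed
  have zero: "poset_length S = 0" if "pbot S = ptop S"
  proof -
    have "\<And>x. x \<in> S \<Longrightarrow> x = pbot S" using D(4,5) that by (auto intro!: antisym)
    then have "\<exists>x. S = {x}" using D(2) by blast
    then have "card S = 1" by (simp add: card_1_singleton_iff)
    then show ?thesis using poset_length_le[OF D(1)] D(2) by fastforce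
  qed
  have le: "poset_length S \<le> 1" if c: "covers S (pbot S) (ptop S)"
  proof -
    have "S \<subseteq> {pbot S, ptop S}" using c D by (auto simp: covers_def less_le)
    then have "card S \<le> 2" using card_mono[of "{pbot S, ptop S}" S] by (auto simp: card_insert_if split: if_splits)
    then show ?thesis using poset_length_le[OF D(1)] D(2) by fastforce
  qed
  show "poset_length S \<ge> 1 \<longleftrightarrow> pbot S \<noteq> ptop S" using one zero by fastforce
  show "poset_length S = 1 \<longleftrightarrow> covers S (pbot S) (ptop S)"
  proof (cases "pbot S = ptop S")
    case True
    then show ?thesis using zero by (auto dest: coversD)
  next
    case False
    then show ?thesis using one two le by fastforce
  qed
qed

lemma atoms_length_one: "covers S (pbot S) (ptop S) \<Longrightarrow> atoms S = {ptop S}"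
  using finite_bounded_posetD[OF fbp] by (auto simp: atoms_def covers_def less_le)

lemma interval_atom:
  assumes "a \<in> atoms S"
  shows "finite_bounded_poset (interval S a (ptop S))"
    "pbot (interval S a (ptop S)) = a" "ptop (interval S a (ptop S)) = ptop S"
    "atoms (interval S a (ptop S)) = {x. covers S a x}"
    "card (interval S a (ptop S)) < card S"
proof -
  note D = finite_bounded_posetD[OF fbp]
  have a: "a \<in> S" "pbot S < a" "a \<le> ptop S" using assms D by (auto simp: atoms_def dest: coversD)
  show "finite_bounded_poset (interval S a (ptop S))"
    "pbot (interval S a (ptop S)) = a" "ptop (interval S a (ptop S)) = ptop S"
    using a D by (simp_all add: finite_bounded_poset_interval pbot_interval ptop_interval)
  show "atoms (interval S a (ptop S)) = {x. covers S a x}"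
    using a D by (auto simp: atoms_interval dest: coversD)
  have "pbot S \<notin> interval S a (ptop S)" using a by (auto simp: interval_def)
  then have "interval S a (ptop S) \<subset> S" using D(2) by (auto simp: interval_def)
  then show "card (interval S a (ptop S)) < card S" using D(1) by (rule psubset_card_mono[rotated])
qed

end

lemma atoms_antichain: "a \<in> atoms S \<Longrightarrow> b \<in> atoms S \<Longrightarrow> a \<le> b \<Longrightarrow> a = b"
  by (auto simp: atoms_def covers_def less_le)

text \<open>When the top is an atom, the recursion reaches a one-point poset, where
  \<open>rao_step\<close> holds with no atoms at all.\<close>

lemma rao_singleton: "rao {x} []"
proof (rule rao_step)
  have "pbot {x} = x" by (rule pbot_eqI) auto
  then show "atom_ordering {x} []" by (auto simp: atom_ordering_def atoms_def covers_def)
qed auto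

text \<open>A single condition for both introduction rules: in length one the interval above the
  only atom is a point. The exception for the first atom disappears as well, since nothing is early
  for it and \<open>take 0\<close> is the required segment.\<close>

definition rao_cond :: "'a::order set \<Rightarrow> 'a list \<Rightarrow> bool" where
  "rao_cond S as \<longleftrightarrow> atom_ordering S as \<and>
     (\<forall>a\<in>set as. \<exists>bs. rao (interval S a (ptop S)) bs \<and>
        (\<exists>m. set (take m bs) = {x \<in> atoms (interval S a (ptop S)). early as a x})) \<and>
     (\<forall>a y. a \<in> set as \<and> y \<in> S \<and> a < y \<and> early as a y \<longrightarrow>
        (\<exists>z. covers S a z \<and> early as a z \<and> z \<le> y))"

lemma rao_condE:
  assumes "rao_cond S as" "a \<in> set as"
  obtains bs m where "rao (interval S a (ptop S)) bs"
    "set (take m bs) = {x \<in> atoms (interval S a (ptop S)). early as a x}"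
  using assms unfolding rao_cond_def by blast

lemma rao_cond_early:
  assumes "rao_cond S as" "a \<in> set as" "y \<in> S" "a < y" "early as a y"
  obtains z where "covers S a z" "early as a z" "z \<le> y"
  using assms unfolding rao_cond_def by blast

lemma rao_cond_step_iff:
  assumes "atom_ordering S as"
  shows "(\<forall>j < length as. \<exists>bs.
        rao (interval S (as ! j) (ptop S)) bs \<and>
        (j \<noteq> 0 \<longrightarrow>
           (\<exists>m. set (take m bs) =
                {x \<in> atoms (interval S (as ! j) (ptop S)). \<exists>k<j. as ! k < x}))) \<and>
     (\<forall>i j y. i < j \<and> j < length as \<and> y \<in> S \<and> as ! i < y \<and> as ! j < y \<longrightarrow>
        (\<exists>k<j. \<exists>z\<in>S. covers S (as ! j) z \<and> as ! k < z \<and> z \<le> y)) \<longleftrightarrow> rao_cond S as"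
proof -
  have d: "distinct as" using assms by (simp add: atom_ordering_def)
  have eq: "(j \<noteq> 0 \<longrightarrow> (\<exists>m. set (take m bs) =
                {x \<in> atoms (interval S (as ! j) (ptop S)). \<exists>k<j. as ! k < x})) \<longleftrightarrow>
      (\<exists>m. set (take m bs) = {x \<in> atoms (interval S (as ! j) (ptop S)). early as (as ! j) x})"
    if "j < length as" for j bs
  proof (cases "j = 0")
    case True
    then show ?thesis using early_nth[OF d that] by (auto intro: exI[of _ 0])
  next
    case False
    then show ?thesis using early_nth[OF d that] by simp
  qed
  have "(\<forall>j < length as. \<exists>bs. rao (interval S (as ! j) (ptop S)) bs \<and>
        (j \<noteq> 0 \<longrightarrow> (\<exists>m. set (take m bs) =
                {x \<in> atoms (interval S (as ! j) (ptop S)). \<exists>k<j. as ! k < x}))) \<longleftrightarrow>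
     (\<forall>a\<in>set as. \<exists>bs. rao (interval S a (ptop S)) bs \<and>
        (\<exists>m. set (take m bs) = {x \<in> atoms (interval S a (ptop S)). early as a x}))"
    unfolding all_set_conv_all_nth by (intro iff_allI iff_exI imp_cong conj_cong refl eq)
  then show ?thesis
    unfolding rao_cond_def early_condition_iff[OF d] using assms by argo
qed

lemma rao_iff:
  assumes "finite_bounded_poset S"
  shows "rao S as \<longleftrightarrow> rao_cond S as"
proof
  assume "rao S as"
  then show "rao_cond S as"
  proof cases
    case rao_length_one
    then have c: "covers S (pbot S) (ptop S)" using poset_length_one_iff assms by blast
    then have "atoms S = {ptop S}" using atoms_length_one assms by blast
    then have "distinct as" "set as = {ptop S}"
      using rao_length_one by (simp_all add: atom_ordering_def)
    then have as: "as = [ptop S]" by (cases as; cases "tl as") auto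
    have "interval S (ptop S) (ptop S) = {ptop S}"
      using finite_bounded_posetD[OF assms] by (auto simp: interval_def)
    then have "rao (interval S (ptop S) (ptop S)) []" using rao_singleton by simp
    moreover have "\<not> early as (ptop S) x" for x by (simp add: as early_def)
    ultimately show ?thesis
      using rao_length_one(2) unfolding rao_cond_def as by auto
  next
    case rao_step
    then show ?thesis by (intro rao_cond_step_iff[THEN iffD1] conjI)
  qed
next
  assume r: "rao_cond S as"
  then have at: "atom_ordering S as" by (simp add: rao_cond_def)
  note * = rao_cond_step_iff[OF at, THEN iffD2, OF r]
  show "rao S as" by (rule rao_step[OF at conjunct1[OF *] conjunct2[OF *]])
qed

text \<open>Condition (i)(b), where \<open>F\<close> stands for the elements above a predecessor,
  but with arbitrary upper ends \<open>y\<close> instead of those two covers above the bottom. The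
  reordering argument uses it at arbitrary \<open>y\<close>.\<close>

definition first_closed :: "'a::order set \<Rightarrow> 'a list \<Rightarrow> 'a set \<Rightarrow> bool" where
  "first_closed T bs F \<longleftrightarrow>
     (\<forall>y\<in>T. \<forall>b\<in>set bs. b \<le> y \<and> b \<in> F \<longrightarrow> hd (filter (\<lambda>b. b \<le> y) bs) \<in> F)"

lemma first_closedE:
  assumes "first_closed T bs F" "distinct bs" "y \<in> T" "b \<in> set bs" "b \<le> y" "b \<in> F"
  obtains c where "c \<in> set bs" "c \<in> F" "c \<le> y" "\<And>d. d \<in> set bs \<Longrightarrow> d \<le> y \<Longrightarrow> d = c \<or> before bs c d"
proof
  let ?c = "hd (filter (\<lambda>b. b \<le> y) bs)"
  show "?c \<in> set bs" "?c \<le> y"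
    using hd_filter_before[OF assms(2,4), of "\<lambda>b. b \<le> y"] assms by auto
  show "?c \<in> F" using assms by (auto simp: first_closed_def)
  fix d assume "d \<in> set bs" "d \<le> y"
  then show "d = ?c \<or> before bs ?c d"
    using hd_filter_before[OF assms(2), of d "\<lambda>b. b \<le> y"] by auto
qed

text \<open>The restriction \<open>a \<noteq> ptop S\<close> lets one condition cover both rules:
  the top is an atom only in length one, and \<open>grao\<close> fails for a one-point
  poset.\<close>

definition grao_cond :: "'a::order set \<Rightarrow> 'a list \<Rightarrow> bool" where
  "grao_cond S as \<longleftrightarrow> atom_ordering S as \<and>
     (\<forall>a\<in>set as. a \<noteq> ptop S \<longrightarrow> (\<exists>bs. grao (interval S a (ptop S)) bs \<and>
        first_closed (interval S a (ptop S)) bs {x. early as a x})) \<and>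
     (\<forall>a y. a \<in> set as \<and> y \<in> S \<and> a < y \<and> early as a y \<longrightarrow>
        (\<exists>z. covers S a z \<and> early as a z \<and> z \<le> y))"

lemma grao_condE:
  assumes "grao_cond S as" "a \<in> set as" "a \<noteq> ptop S"
  obtains bs where "grao (interval S a (ptop S)) bs"
    "first_closed (interval S a (ptop S)) bs {x. early as a x}"
  using assms unfolding grao_cond_def by blast

lemma grao_cond_early:
  assumes "grao_cond S as" "a \<in> set as" "y \<in> S" "a < y" "early as a y"
  obtains z where "covers S a z" "early as a z" "z \<le> y"
  using assms unfolding grao_cond_def by blast

lemma grao_condI:
  assumes fbp: "finite_bounded_poset S" "pbot S \<noteq> ptop S" and g: "grao_cond S as"
  shows "grao S as"
proof (cases "poset_length S = 1")
  case True
  then show ?thesis using g grao_length_one by (auto simp: grao_cond_def)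
next
  case False
  then have len: "poset_length S > 1" using poset_length_pos_iff fbp by fastforce
  have at: "atom_ordering S as" using g by (simp add: grao_cond_def)
  then have d: "distinct as" and set: "set as = atoms S" by (simp_all add: atom_ordering_def)
  have ec: "\<forall>i j y. i < j \<and> j < length as \<and> y \<in> S \<and> as ! i < y \<and> as ! j < y \<longrightarrow>
        (\<exists>k<j. \<exists>z\<in>S. z \<le> y \<and> covers S (as ! j) z \<and> as ! k < z)"
    using conjunct2[OF conjunct2[OF g[unfolded grao_cond_def]]]
    unfolding early_condition_iff[OF d, symmetric] by (simp only: conj_ac)
  show ?thesis
  proof (rule grao_step[OF len at _ ec], intro allI impI)
    fix j assume j: "j < length as"
    let ?a = "as ! j"
    have a: "?a \<in> set as" using j by simp
    have "?a \<noteq> ptop S" using a set False poset_length_one_iff[OF fbp(1)] unfolding atoms_def by auto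
    then obtain bs where bs: "grao (interval S ?a (ptop S)) bs"
      "first_closed (interval S ?a (ptop S)) bs {x. early as ?a x}"
      using g a unfolding grao_cond_def by blast
    show "\<exists>bs. grao (interval S ?a (ptop S)) bs \<and>
        (\<forall>x w. covers S ?a x \<and> covers S x w \<longrightarrow>
           (\<exists>i<j. as ! i < hd (filter (\<lambda>b. b \<le> w) bs)) \<or>
           (\<forall>b \<in> set (filter (\<lambda>b. b \<le> w) bs). \<not> (\<exists>i<j. as ! i < b)))"
    proof (intro exI[of _ bs] conjI bs allI impI)
      fix x w assume "covers S ?a x \<and> covers S x w"
      then have "w \<in> interval S ?a (ptop S)"
        using finite_bounded_posetD[OF fbp(1)] by (auto simp: interval_def dest!: coversD)
      then show "(\<exists>i<j. as ! i < hd (filter (\<lambda>b. b \<le> w) bs)) \<or>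
           (\<forall>b \<in> set (filter (\<lambda>b. b \<le> w) bs). \<not> (\<exists>i<j. as ! i < b))"
        using bs(2) early_nth[OF d j] unfolding first_closed_def by auto
    qed
  qed
qed

lemma grao_pos:
  assumes "grao S as" "finite_bounded_poset S"
  shows "pbot S \<noteq> ptop S"
proof -
  from assms(1) have "poset_length S \<ge> 1" by cases auto
  then show ?thesis using poset_length_pos_iff[OF assms(2)] by simp
qed

lemma grao_atom_ordering: "grao S as \<Longrightarrow> atom_ordering S as"
  by (cases rule: grao.cases) auto

lemma grao_early:
  assumes "grao S as" "finite_bounded_poset S" "before as a b" "y \<in> S" "a < y" "b < y"
  shows "\<exists>z. covers S b z \<and> early as b z \<and> z \<le> y"
  using assms(1)
proof (cases rule: grao.cases)
  case grao_length_one
  then have "covers S (pbot S) (ptop S)" using poset_length_one_iff assms by blast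
  then have "atoms S = {ptop S}" using atoms_length_one assms by blast
  then have "b = ptop S" using grao_length_one before_mem[OF assms(3)]
    by (auto simp: atom_ordering_def)
  then show ?thesis using assms finite_bounded_posetD(5)[OF assms(2)] by fastforce
next
  case grao_step
  then have d: "distinct as" by (simp add: atom_ordering_def)
  have "early as b y" using assms by (auto simp: early_def)
  moreover have "\<forall>a y. a \<in> set as \<and> y \<in> S \<and> a < y \<and> early as a y \<longrightarrow>
        (\<exists>z. covers S a z \<and> early as a z \<and> z \<le> y)"
    unfolding early_condition_iff[OF d, symmetric] using grao_step(4) by (simp only: conj_ac)
  ultimately show ?thesis using assms before_mem by metis
qed

text \<open>Condition (i)(b) only concerns the intervals \<open>[a, w]\<close> with \<open>a \<lessdot> x \<lessdot> w\<close>. It propagates to all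
  intervals \<open>[a, y]\<close>: were the first atom of \<open>[a, y]\<close> in \<open>F\<close> not the first atom of \<open>[a, y]\<close>,
  then (ii) would lead to an earlier one in \<open>F\<close>.\<close>

lemma first_closedI:
  assumes g: "grao T bs" and fbp: "finite_bounded_poset T"
    and F: "\<And>b w. b \<in> set bs \<Longrightarrow> covers T b w \<Longrightarrow> b \<in> F \<Longrightarrow> hd (filter (\<lambda>b. b \<le> w) bs) \<in> F"
  shows "first_closed T bs F"
  unfolding first_closed_def
proof (intro ballI impI)
  fix y b assume y: "y \<in> T" and b: "b \<in> set bs" "b \<le> y \<and> b \<in> F"
  have d: "distinct bs" and set: "set bs = atoms T"
    using grao_atom_ordering[OF g] by (simp_all add: atom_ordering_def)
  let ?Q = "\<lambda>b. b \<le> y \<and> b \<in> F"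
  define p where "p = hd (filter ?Q bs)"
  have p: "p \<in> set bs" "?Q p"
    unfolding p_def using hd_filter_before(1,2)[OF d b(1), of ?Q] b(2) by auto
  have pmin: "b = p \<or> before bs p b" if "b \<in> set bs" "?Q b" for b
    unfolding p_def using hd_filter_before(3)[OF d that(1), of ?Q] that(2) by auto
  let ?f = "hd (filter (\<lambda>b. b \<le> y) bs)"
  have f: "?f \<in> set bs" "?f \<le> y" "p = ?f \<or> before bs ?f p"
    using hd_filter_before[OF d p(1), of "\<lambda>b. b \<le> y"] p(2) by auto
  have "p = ?f"
  proof (rule ccontr)
    assume ne: "p \<noteq> ?f"
    then have fp: "before bs ?f p" using f by blast
    have fa: "?f \<in> atoms T" "p \<in> atoms T" using f(1) p(1) set by blast+
    then have "?f \<noteq> y" "p \<noteq> y" using atoms_antichain ne f(2) p(2) by metis+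
    then have "?f < y" "p < y" using f(2) p(2) by (simp_all add: less_le)
    then obtain z where z: "covers T p z" "early bs p z" "z \<le> y"
      using grao_early[OF g fbp fp y] by blast
    let ?h = "hd (filter (\<lambda>b. b \<le> z) bs)"
    obtain k where k: "before bs k p" "k < z" using z by (auto simp: early_def)
    have h: "?h \<in> set bs" "?h \<le> z" "k = ?h \<or> before bs ?h k"
      using hd_filter_before[OF d, of k "\<lambda>b. b \<le> z"] k before_mem[OF k(1)] by auto
    have hp: "before bs ?h p" using h(3) k(1) before_trans[OF d _ k(1), of ?h] by metis
    \<comment> \<open>\<open>p\<close> is in \<open>F\<close> and covered by \<open>z\<close>, so
      the hypothesis on covers puts the first element below \<open>z\<close> into \<open>F\<close>.
      It precedes \<open>p\<close>, because \<open>k\<close> does.\<close>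
    have "?Q ?h" using F[OF p(1) z(1)] p(2) h(2) z(3) order_trans by blast
    then have "before bs p p" using pmin[OF h(1)] hp before_trans[OF d _ hp, of p] by metis
    then show False using before_irrefl[OF d] by blast
  qed
  then show "?f \<in> F" using p by simp
qed

lemma grao_condD:
  assumes fbp: "finite_bounded_poset S" and g: "grao S as"
  shows "grao_cond S as"
proof -
  have at: "atom_ordering S as" using g grao_atom_ordering by blast
  then have d: "distinct as" and set: "set as = atoms S" by (simp_all add: atom_ordering_def)
  have "\<exists>bs. grao (interval S a (ptop S)) bs \<and>
        first_closed (interval S a (ptop S)) bs {x. early as a x}"
    if a: "a \<in> set as" "a \<noteq> ptop S" for a
    using g
  proof (cases rule: grao.cases)
    case grao_length_one
    then have "covers S (pbot S) (ptop S)" using poset_length_one_iff fbp by blast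
    then have "atoms S = {ptop S}" using atoms_length_one fbp by blast
    then show ?thesis using a set by simp
  next
    case grao_step
    obtain j where j: "j < length as" "as ! j = a" using a by (metis in_set_conv_nth)
    let ?I = "interval S a (ptop S)"
    obtain bs where bs: "grao ?I bs"
      and w: "\<And>x w. covers S a x \<Longrightarrow> covers S x w \<Longrightarrow>
           (\<exists>i<j. as ! i < hd (filter (\<lambda>b. b \<le> w) bs)) \<or>
           (\<forall>b \<in> set (filter (\<lambda>b. b \<le> w) bs). \<not> (\<exists>i<j. as ! i < b))"
      using grao_step(3)[rule_format, OF j(1)] unfolding j(2) by blast
    have I: "finite_bounded_poset ?I" "atoms ?I = {x. covers S a x}"
      using interval_atom[OF fbp] a set by simp_all
    have "first_closed ?I bs {x. early as a x}"
    proof (rule first_closedI[OF bs I(1)])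
      fix b w' assume b: "b \<in> set bs" "covers ?I b w'" "b \<in> {x. early as a x}"
      then have "covers S a b" "covers S b w'"
        using grao_atom_ordering[OF bs] I by (auto simp: atom_ordering_def covers_interval)
      \<comment> \<open>In (i)(b) the middle element is \<open>b\<close> itself. It is an early atom
        below \<open>w'\<close>, which rules out the second alternative.\<close>
      then show "hd (filter (\<lambda>b. b \<le> w') bs) \<in> {x. early as a x}"
        using w[of b w'] b early_nth[OF d j(1)] j by (auto dest: coversD)
    qed
    then show ?thesis using bs by blast
  qed
  moreover have "\<forall>a y. a \<in> set as \<and> y \<in> S \<and> a < y \<and> early as a y \<longrightarrow>
        (\<exists>z. covers S a z \<and> early as a z \<and> z \<le> y)"
    using grao_early[OF g fbp] unfolding early_def by blast
  ultimately show ?thesis using at unfolding grao_cond_def by blast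
qed

section \<open>Equivalence of the two kinds of atom orderings\<close>

text \<open>Restricting a list keeps its order, so if the initial segment has any element below
  \<open>y\<close>, the first element below \<open>y\<close> belongs to the segment.\<close>

lemma first_closed_take:
  assumes "set (take m bs) = {x \<in> A. x \<in> F}" "set bs = A"
  shows "first_closed T bs F"
  unfolding first_closed_def
proof (intro ballI impI)
  fix y b assume "b \<in> set bs" "b \<le> y \<and> b \<in> F"
  then have b: "b \<in> set (filter (\<lambda>b. b \<le> y) (take m bs))" using assms by auto
  have "filter (\<lambda>b. b \<le> y) bs = filter (\<lambda>b. b \<le> y) (take m bs) @ filter (\<lambda>b. b \<le> y) (drop m bs)"
    by (metis append_take_drop_id filter_append)
  then have "hd (filter (\<lambda>b. b \<le> y) bs) = hd (filter (\<lambda>b. b \<le> y) (take m bs))"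
    using b by (metis empty_iff empty_set hd_append)
  also have "\<dots> \<in> set (take m bs)"
    using b by (metis empty_iff empty_set filter_is_subset hd_in_set subsetD)
  finally show "hd (filter (\<lambda>b. b \<le> y) bs) \<in> F" using assms by auto
qed

text \<open>All orderings stay the same. The induction is on the cardinality, because the interval
  above an atom omits the bottom.\<close>

lemma rao_imp_grao:
  assumes "finite_bounded_poset S" "pbot S \<noteq> ptop S" "rao S as"
  shows "grao S as"
  using assms
proof (induction "card S" arbitrary: S as rule: less_induct)
  case less
  have r: "rao_cond S as" using less(4) rao_iff[OF less(2)] by simp
  then have at: "atom_ordering S as" by (simp add: rao_cond_def)
  have "\<exists>bs. grao (interval S a (ptop S)) bs \<and>
        first_closed (interval S a (ptop S)) bs {x. early as a x}"
    if a: "a \<in> set as" "a \<noteq> ptop S" for a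
  proof -
    let ?I = "interval S a (ptop S)"
    have aa: "a \<in> atoms S" using a at by (simp add: atom_ordering_def)
    note I = interval_atom[OF less(2) aa]
    obtain bs m where bs: "rao ?I bs" "set (take m bs) = {x \<in> atoms ?I. early as a x}"
      using rao_condE[OF r a(1)] by blast
    have "pbot ?I \<noteq> ptop ?I" using I(2,3) a(2) by simp
    then have g: "grao ?I bs" using less(1)[OF I(5) I(1)] bs(1) by blast
    then have "set bs = atoms ?I"
      using grao_atom_ordering[OF g] by (simp add: atom_ordering_def)
    then have "first_closed ?I bs {x. early as a x}"
      by (intro first_closed_take[of m bs "atoms ?I"]) (simp_all add: bs(2))
    then show ?thesis using g by blast
  qed
  then have "grao_cond S as" using r unfolding grao_cond_def rao_cond_def by simp
  then show ?case by (rule grao_condI[OF less(2,3)])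
qed

text \<open>The rearrangement leaves \<open>early\<close> unchanged at elements above
  \<open>a\<close>: if an element of \<open>F\<close> is involved, the first atom \<open>c\<close>
  below \<open>x\<close> lies in \<open>F\<close> by closedness, and \<open>c\<close> can replace
  the predecessor whose position changed. So the orderings at deeper levels can be kept.\<close>

lemma grao_reorder:
  assumes fbp: "finite_bounded_poset S" and g: "grao S as" and F: "first_closed S as F"
  shows "grao S (filter (\<lambda>x. x \<in> F) as @ filter (\<lambda>x. x \<notin> F) as)" (is "grao S ?as")
proof (rule grao_condI[OF fbp grao_pos[OF g fbp]])
  have c: "grao_cond S as" using grao_condD fbp g by blast
  then have at: "atom_ordering S as" by (simp add: grao_cond_def)
  then have d: "distinct as" and set: "set as = atoms S" by (simp_all add: atom_ordering_def)
  have b: "before ?as a b \<longleftrightarrow> (a \<in> F \<longleftrightarrow> b \<in> F) \<and> before as a b \<or>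
      a \<in> F \<and> b \<notin> F \<and> a \<in> set as \<and> b \<in> set as" for a b
    by (auto simp: before_append before_filter)
  \<comment> \<open>The new predecessors of an \<open>a\<close> outside \<open>F\<close> are
    elements \<open>k\<close> of \<open>F\<close>. For each such \<open>k\<close> below
    \<open>x\<close>, the atom \<open>c\<close> preceded \<open>a\<close> already before.\<close>
  have E1: "early as a x" if e: "early ?as a x" and x: "x \<in> S" and ax: "a \<le> x" for a x
  proof -
    obtain k where k: "before ?as k a" "k < x" using e unfolding early_def by blast
    show ?thesis
    proof (cases "before as k a")
      case True
      then show ?thesis using k by (auto simp: early_def)
    next
      case False
      then have k': "k \<in> F" "a \<notin> F" "k \<in> set as" "a \<in> set as" using k(1) b[of k a] by blast+
      obtain c where c: "c \<in> set as" "c \<in> F" "c \<le> x"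
        and cmin: "\<And>d. d \<in> set as \<Longrightarrow> d \<le> x \<Longrightarrow> d = c \<or> before as c d"
        using first_closedE[OF F d x k'(3) less_imp_le[OF k(2)] k'(1)] by blast
      have "before as c a" using cmin[OF k'(4) ax] c(2) k'(2) by blast
      \<comment> \<open>\<open>early\<close> asks for \<open>c < x\<close>; equality would put the
        atom \<open>k\<close> strictly below the atom \<open>c\<close>.\<close>
      moreover have "c \<noteq> x"
        using atoms_antichain[of k S c] c(1) k(2) k'(3) set by (metis less_imp_le less_irrefl)
      ultimately show ?thesis using c(3) unfolding early_def by (metis less_le)
    qed
  qed
  \<comment> \<open>An \<open>a\<close> in \<open>F\<close> loses the predecessors \<open>k\<close>
    outside \<open>F\<close>. The atom \<open>c\<close> precedes \<open>k\<close>, hence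
    \<open>a\<close>, and keeps doing so because both \<open>c\<close> and \<open>a\<close> are in
    \<open>F\<close>.\<close>
  have E2: "early ?as a x" if e: "early as a x" and x: "x \<in> S" "a < x" and a: "a \<in> set as" for a x
  proof -
    obtain k where k: "before as k a" "k < x" using e unfolding early_def by blast
    show ?thesis
    proof (cases "a \<in> F \<and> k \<notin> F")
      case False
      then have "before ?as k a" using k(1) b[of k a] before_mem[OF k(1)] by blast
      then show ?thesis using k by (auto simp: early_def)
    next
      case True
      obtain c where c: "c \<in> set as" "c \<in> F" "c \<le> x"
        and cmin: "\<And>d. d \<in> set as \<Longrightarrow> d \<le> x \<Longrightarrow> d = c \<or> before as c d"
        using first_closedE[OF F d x(1) a less_imp_le[OF x(2)]] True by blast
      have k': "k \<in> set as" using before_mem[OF k(1)] by blast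
      have "before as c k" using cmin[OF k' less_imp_le[OF k(2)]] True c(2) by blast
      then have "before as c a" using before_trans[OF d _ k(1)] by blast
      then have "before ?as c a" using b[of c a] True c(2) by blast
      moreover have "c \<noteq> x"
        using atoms_antichain[of k S c] c(1) k(2) k' set by (metis less_imp_le less_irrefl)
      ultimately show ?thesis using c(3) unfolding early_def by (metis less_le)
    qed
  qed
  show "grao_cond S ?as"
    unfolding grao_cond_def
  proof (intro conjI ballI allI impI)
    show "atom_ordering S ?as" using at by (auto simp: atom_ordering_def)
    fix a assume "a \<in> set ?as" "a \<noteq> ptop S"
    then have a: "a \<in> set as" "a \<noteq> ptop S" by auto
    let ?I = "interval S a (ptop S)"
    obtain bs where bs: "grao ?I bs" "first_closed ?I bs {x. early as a x}"
      using grao_condE[OF c a] by blast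
    have I: "atoms ?I = {x. covers S a x}" using interval_atom[OF fbp] a set by simp
    then have sb: "set bs = {x. covers S a x}"
      using grao_atom_ordering[OF bs(1)] by (simp add: atom_ordering_def)
    have "first_closed ?I bs {x. early ?as a x}"
      unfolding first_closed_def
    proof (intro ballI impI)
      fix y x assume y: "y \<in> ?I" and x: "x \<in> set bs" "x \<le> y \<and> x \<in> {x. early ?as a x}"
      then have "early as a x" using E1 sb by (auto dest: coversD)
      then have h: "hd (filter (\<lambda>b. b \<le> y) bs) \<in> {x. early as a x}"
        using bs(2) y x unfolding first_closed_def by blast
      have "hd (filter (\<lambda>b. b \<le> y) bs) \<in> set bs"
        using x by (metis (mono_tags, lifting) empty_filter_conv filter_is_subset hd_in_set subsetD)
      then show "hd (filter (\<lambda>b. b \<le> y) bs) \<in> {x. early ?as a x}"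
        using h E2 sb a by (auto dest: coversD)
    qed
    then show "\<exists>bs. grao ?I bs \<and> first_closed ?I bs {x. early ?as a x}" using bs by blast
  next
    fix a y assume *: "a \<in> set ?as \<and> y \<in> S \<and> a < y \<and> early ?as a y"
    then have a: "a \<in> set as" "early as a y" using E1 by auto
    then obtain z where z: "covers S a z" "early as a z" "z \<le> y"
      using grao_cond_early[OF c a(1) _ _ a(2)] * by blast
    then show "\<exists>z. covers S a z \<and> early ?as a z \<and> z \<le> y"
      using E2[OF z(2)] a by (auto dest: coversD)
  qed
qed

text \<open>The induction keeps the given ordering \<open>as\<close>. The ordering of the atoms of
  [a, 1] is rearranged before the induction hypothesis is applied to it, so all deeper levels adapt
  to the new order.\<close>

lemma grao_imp_rao:
  assumes "finite_bounded_poset S" "grao S as"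
  shows "rao S as"
  using assms
proof (induction "card S" arbitrary: S as rule: less_induct)
  case less
  have g: "grao_cond S as" by (rule grao_condD[OF less(2,3)])
  then have at: "atom_ordering S as" by (simp add: grao_cond_def)
  have "\<exists>bs. rao (interval S a (ptop S)) bs \<and>
        (\<exists>m. set (take m bs) = {x \<in> atoms (interval S a (ptop S)). early as a x})"
    if a: "a \<in> set as" for a
  proof (cases "a = ptop S")
    case True
    have "interval S a (ptop S) = {ptop S}"
      using True finite_bounded_posetD[OF less(2)] by (auto simp: interval_def)
    moreover have "pbot {ptop S} = ptop S" by (rule pbot_eqI) auto
    ultimately show ?thesis using rao_singleton
      by (intro exI[of _ "[]"]) (auto simp: atoms_def covers_def)
  next
    case False
    let ?I = "interval S a (ptop S)"
    let ?F = "{x. early as a x}"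
    have aa: "a \<in> atoms S" using a at by (simp add: atom_ordering_def)
    note I = interval_atom[OF less(2) aa]
    obtain bs where bs: "grao ?I bs" "first_closed ?I bs ?F"
      using grao_condE[OF g a False] by blast
    let ?bs = "filter (\<lambda>x. x \<in> ?F) bs @ filter (\<lambda>x. x \<notin> ?F) bs"
    have "rao ?I ?bs" by (rule less(1)[OF I(5,1) grao_reorder[OF I(1) bs]])
    moreover have "set bs = atoms ?I"
      using grao_atom_ordering[OF bs(1)] by (simp add: atom_ordering_def)
    then have "set (take (length (filter (\<lambda>x. x \<in> ?F) bs)) ?bs) = {x \<in> atoms ?I. early as a x}"
      by simp
    ultimately show ?thesis by blast
  qed
  then have "rao_cond S as" using g unfolding grao_cond_def rao_cond_def by simp
  then show ?case using rao_iff[OF less(2)] by simp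
qed

lemma admits_RAO_iff_GRAO:
  assumes "finite_bounded_poset P" "poset_length P \<ge> 1"
  shows "admits_RAO P \<longleftrightarrow> admits_GRAO P"
  using assms rao_imp_grao grao_imp_rao poset_length_pos_iff
  unfolding admits_RAO_def admits_GRAO_def by blast

section \<open>From self-consistent TCL-labelings to atom orderings\<close>

text \<open>The conclusion is negative because \<open>r\<close> is partial: incomparable elements
  may stand in either order.\<close>

lemma ex_linear_extension:
  assumes "finite A" "asymp_on A r" "transp_on A r"
  shows "\<exists>xs. distinct xs \<and> set xs = A \<and> (\<forall>a b. before xs a b \<longrightarrow> \<not> r b a)"
  using assms
proof (induction A rule: finite_psubset_induct)
  case (psubset A)
  show ?case
  proof (cases "A = {}")
    case True
    then show ?thesis by (intro exI[of _ "[]"]) auto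
  next
    case False
    then obtain m where m: "m \<in> A" "\<forall>x\<in>A. x \<noteq> m \<longrightarrow> \<not> r x m"
      using Finite_Set.bex_min_element[OF psubset(1,3,4)] by blast
    have "A - {m} \<subset> A" using m by blast
    moreover have "asymp_on (A - {m}) r" "transp_on (A - {m}) r"
      using asymp_on_subset[OF psubset(3)] transp_on_subset[OF psubset(4)] by simp_all
    ultimately have "\<exists>xs. distinct xs \<and> set xs = A - {m} \<and> (\<forall>a b. before xs a b \<longrightarrow> \<not> r b a)"
      by (rule psubset(2))
    then obtain xs where xs: "distinct xs" "set xs = A - {m}" "\<forall>a b. before xs a b \<longrightarrow> \<not> r b a"
      by blast
    have "\<not> r b a" if ab: "before (m # xs) a b" for a b
    proof (cases "before xs a b")
      case False
      then have "a = m" "b \<in> A" "b \<noteq> m" using ab xs(2) by auto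
      then show ?thesis using m(2) by blast
    qed (use xs(3) in blast)
    moreover have "distinct (m # xs)" "set (m # xs) = A" using xs(1,2) m(1) by auto
    ultimately show ?thesis by (intro exI[of _ "m # xs"]) blast
  qed
qed

context chain_labeled
begin

text \<open>Chains run up to the top, so that one ordering serves all intervals [u, v] with the same
  root.\<close>

definition prec :: "'a \<Rightarrow> 'a list \<Rightarrow> 'a \<Rightarrow> 'a \<Rightarrow> bool" where
  "prec u r a b \<longleftrightarrow> (\<forall>c d. path P u (ptop P) c \<and> a \<in> set c \<and> path P u (ptop P) d \<and> b \<in> set d \<longrightarrow>
     L r c \<prec> L r d)"

text \<open>Keeps \<open>prec\<close> from holding vacuously; its irreflexivity and its transitivity
  depend on this.\<close>

lemma ex_path_via:
  assumes "covers P u a"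
  shows "\<exists>c. path P u (ptop P) c \<and> a \<in> set c"
proof -
  have "a \<in> P" using assms coversD by blast
  then obtain c where c: "path P a (ptop P) c" using ex_path[OF finP _ top_mem le_top] by blast
  moreover obtain c' where "c = a # c'" using path_hd[OF c] by blast
  ultimately have "path P u (ptop P) (u # a # c')" using assms by simp
  then show ?thesis by (intro exI[of _ "u # a # c'"]) simp
qed

definition compatible :: "'a \<Rightarrow> 'a list \<Rightarrow> 'a list \<Rightarrow> bool" where
  "compatible u r as \<longleftrightarrow> distinct as \<and> set as = {a. covers P u a} \<and>
     (\<forall>a b. before as a b \<longrightarrow> \<not> prec u r b a)"

lemma ex_compatible: "\<exists>as. compatible u r as"
  unfolding compatible_def
proof (rule ex_linear_extension)
  let ?A = "{a. covers P u a}"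
  have "?A \<subseteq> P" using coversD by blast
  then show "finite ?A" using finP finite_subset by blast
  have irr: "\<not> prec u r a a" if "covers P u a" for a
    using ex_path_via[OF that] earlier_irrefl unfolding prec_def by blast
  have tr: "prec u r a c" if b: "covers P u b" and ab: "prec u r a b" and bc: "prec u r b c" for a b c
    unfolding prec_def
  proof (intro allI impI)
    fix p q assume *: "path P u (ptop P) p \<and> a \<in> set p \<and> path P u (ptop P) q \<and> c \<in> set q"
    obtain d where d: "path P u (ptop P) d" "b \<in> set d" using ex_path_via[OF b] by blast
    have "L r p \<prec> L r d" using ab * d unfolding prec_def by blast
    moreover have "L r d \<prec> L r q" using bc * d unfolding prec_def by blast
    ultimately show "L r p \<prec> L r q" by (rule earlier_trans)
  qed
  show "transp_on ?A (prec u r)" by (rule transp_onI, rule tr) simp_all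
  show "asymp_on ?A (prec u r)"
  proof (rule asymp_onI, rule notI)
    fix a b assume "a \<in> ?A" "b \<in> ?A" "prec u r a b" "prec u r b a"
    then show False using tr[of b a a] irr[of a] by simp
  qed
qed

context
  assumes TCL: "TCL_labeling P Q R lam" and SC: "self_consistent P R lam"
begin

lemma SC_first: "rooted_interval P u v r \<Longrightarrow> \<exists>c. first u v r c"
  using SC unfolding self_consistent_def by blast

lemma TCL_first:
  assumes "rooted_interval P u v r" "path P u v c" "all_topological_ascents P R lam r c"
  shows "first u v r c"
proof (rule ccontr)
  assume "\<not> first u v r c"
  then have "has_topological_descent P R lam r c"
    using TCL assms(1) sat_iff[OF assms(1)] assms(2) unfolding TCL_labeling_def by blast
  then show False using has_descent_iff[OF assms(2)] assms(3) by blast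
qed

text \<open>Self-consistency with \<open>v'\<close> the top carries the comparison of the two atoms
  from [u, v] to the chains used by \<open>prec\<close>.\<close>

lemma first_before:
  assumes ri: "rooted_interval P u v r" and f: "first u v r (u # a # c)"
    and as: "compatible u r as" and b: "covers P u b" "b \<le> v" "b \<noteq> a"
  shows "before as a b"
proof -
  have p: "path P u v (u # a # c)" using f first_iff[OF ri] by blast
  then have a: "covers P u a" "a \<le> v" by (auto dest: path_le)
  have u: "u \<in> P" "u \<le> ptop P" using a le_top by (auto dest: coversD)
  have rt: "rooted_interval P u (ptop P) r"
    using ri u top_mem by (simp add: rooted_interval_iff)
  have "a \<le> ptop P" "b \<le> ptop P" "a \<in> P" "b \<in> P" "u \<le> a" "u \<le> b"
    using a b le_top by (auto dest!: coversD)
  then have mem: "a \<in> interval P u (ptop P)" "b \<in> interval P u (ptop P)"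
    by (simp_all add: interval_def)
  have at: "a \<in> atoms (interval P u v)" "b \<in> atoms (interval P u v)"
    using a b atoms_rooted[OF ri] by simp_all
  have "prec u r a b"
    unfolding prec_def
  proof (intro allI impI)
    fix c' d
    assume *: "path P u (ptop P) c' \<and> a \<in> set c' \<and> path P u (ptop P) d \<and> b \<in> set d"
    have all: "\<And>u v r c a b. rooted_interval P u v r \<and> lex_first P R lam u v r c \<and>
        a \<in> atoms (interval P u v) \<and> a \<in> set c \<and>
        b \<in> atoms (interval P u v) \<and> b \<noteq> a \<Longrightarrow>
        (\<forall>v'. rooted_interval P u v' r \<and> a \<in> interval P u v' \<and> b \<in> interval P u v' \<longrightarrow>
           (\<forall>ca cb. saturated_chain P u v' ca \<and> a \<in> set ca \<and>
                    saturated_chain P u v' cb \<and> b \<in> set cb \<longrightarrow> L r ca \<prec> L r cb))"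
      using SC unfolding self_consistent_def by blast
    have "a \<in> set (u # a # c)" by simp
    then have "\<forall>v'. rooted_interval P u v' r \<and> a \<in> interval P u v' \<and> b \<in> interval P u v' \<longrightarrow>
           (\<forall>ca cb. saturated_chain P u v' ca \<and> a \<in> set ca \<and>
                    saturated_chain P u v' cb \<and> b \<in> set cb \<longrightarrow> L r ca \<prec> L r cb)"
      using ri f at b(3) by (intro all[of u v r "u # a # c" a b] conjI)
    then show "L r c' \<prec> L r d"
      using rt mem * sat_iff[OF rt] by blast
  qed
  moreover have "before as a b \<or> before as b a"
    using as a b by (intro before_total) (auto simp: compatible_def)
  ultimately show ?thesis using as unfolding compatible_def by blast
qed

text \<open>If \<open>f\<close> were not early, \<open>u\<close>, \<open>a\<close>, \<open>f\<close>
  would be a topological ascent. Then \<open>u # a # f # c\<close> would have no descent and be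
  first in [u, y] by the TCL condition, although an atom preceding \<open>a\<close> lies below
  \<open>y\<close>.\<close>

lemma first_step_early:
  assumes r: "root r u" and ua: "covers P u a" and as: "compatible u r as"
    and y: "y \<in> P" "a < y" "early as a y"
    and f: "first a y (r @ [a]) (a # f # c)"
  shows "early as a f"
proof (rule ccontr)
  assume ne: "\<not> early as a f"
  have d: "distinct as" and set: "set as = {a. covers P u a}"
    using as by (simp_all add: compatible_def)
  have ra: "root (r @ [a]) a" using path_snoc[OF r ua] .
  have ria: "rooted_interval P a y (r @ [a])" using ra y by (simp add: rooted_interval_iff)
  have p: "path P a y (a # f # c)" using f first_iff[OF ria] by blast
  then have af: "covers P a f" by simp
  have uf: "u < f" "f \<in> P" "u \<noteq> f" using ua af by (auto dest!: coversD)
  have rif: "rooted_interval P u f r" using r uf by (simp add: rooted_interval_iff)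
  obtain e where e: "first u f r e" using SC_first[OF rif] by blast
  then have pe: "path P u f e" using first_iff[OF rif] by blast
  then obtain g e' where g: "e = u # g # e'" "covers P u g" "path P g f (g # e')"
    using path_neqE[OF pe uf(3)] by blast
  have "g \<le> f" using path_le[OF g(3)] .
  moreover have "g \<noteq> f" using g(2) ua af by (auto simp: covers_def)
  ultimately have gf: "g < f" by simp
  have "a \<le> f" using af by (auto dest: coversD)
  \<comment> \<open>Otherwise \<open>g\<close>, which starts the first chain of [u, f], precedes
    \<open>a\<close>, and \<open>g < f\<close> makes \<open>f\<close> early.\<close>
  then have "g = a"
    using first_before[OF rif e[unfolded g(1)] as ua] gf ne unfolding early_def by blast
  then have "e = [u, a, f]" using g path_cover[OF af] by simp
  then have "topological_ascent P R lam r u a f"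
    using e ua af topological_ascent_iff[OF r, of a f] by simp
  moreover have "all_topological_ascents P R lam (r @ [a]) (a # f # c)"
    by (rule first_all_topological_ascents[OF SC_first ria f])
  ultimately have "all_topological_ascents P R lam r (u # a # f # c)"
    by (simp add: ata_Cons)
  moreover have uy: "u \<le> y" using ua y by (auto dest: coversD)
  then have riy: "rooted_interval P u y r" using r y by (simp add: rooted_interval_iff)
  have "path P u y (u # a # f # c)" using ua p by simp
  ultimately have fy: "first u y r (u # a # f # c)" using TCL_first[OF riy] by blast
  obtain k where k: "before as k a" "k < y" using y(3) unfolding early_def by blast
  have "covers P u k" using before_mem[OF k(1)] set by blast
  moreover have "k \<noteq> a" using k(1) before_irrefl[OF d] by blast
  ultimately have "before as a k" using first_before[OF riy fy as] k(2) by simp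
  then show False using k(1) before_trans[OF d] before_irrefl[OF d] by blast
qed

text \<open>Both conditions come from the first chain of [a, y]: its second element \<open>f\<close>
  is the \<open>z\<close> of (ii), and it heads the restriction to [a, y] of every compatible
  ordering of the covers of \<open>a\<close>, as (i)(b) requires.\<close>

lemma compatible_grao:
  assumes "root r u" "u \<noteq> ptop P" "compatible u r as"
  shows "grao (interval P u (ptop P)) as"
  using assms
proof (induction u arbitrary: r as rule: cover_induct[OF finP])
  case (1 u)
  note r = 1(2) and as = 1(4)
  let ?S = "interval P u (ptop P)"
  have u: "u \<in> P" "u \<le> ptop P" using root_mem[OF r] le_top by blast+
  have S: "finite_bounded_poset ?S" "pbot ?S = u" "ptop ?S = ptop P"
    using finite_bounded_poset_interval[OF finP u(1) top_mem u(2)]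
      pbot_interval[OF u] ptop_interval[OF top_mem u(2)] by simp_all
  have d: "distinct as" and set: "set as = {a. covers P u a}"
    using as by (simp_all add: compatible_def)
  have atS: "atoms ?S = {a. covers P u a}"
    using atoms_interval[OF u] le_top by (auto dest: coversD)
  have fst: "\<exists>f c. first a y (r @ [a]) (a # f # c) \<and> covers P a f \<and> f \<le> y"
    if a: "covers P u a" and y: "y \<in> P" "a < y" for a y
  proof -
    have ri: "rooted_interval P a y (r @ [a])"
      using path_snoc[OF r a] y by (simp add: rooted_interval_iff)
    obtain c where c: "first a y (r @ [a]) c" using SC_first[OF ri] by blast
    then have p: "path P a y c" using first_iff[OF ri] by blast
    obtain f c' where "c = a # f # c'" "covers P a f" "path P f y (f # c')"
      using path_neqE[OF p] y(2) by blast
    then show ?thesis using c path_le by blast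
  qed
  have "grao_cond ?S as"
    unfolding grao_cond_def S(3)
  proof (intro conjI ballI allI impI)
    show "atom_ordering ?S as" using d set atS by (simp add: atom_ordering_def)
    fix a assume a: "a \<in> set as" "a \<noteq> ptop P"
    then have ua: "covers P u a" using set by blast
    have ra: "root (r @ [a]) a" using path_snoc[OF r ua] .
    have I: "interval ?S a (ptop P) = interval P a (ptop P)"
      using ua by (intro interval_interval) (auto dest: coversD)
    obtain bs where bs: "compatible a (r @ [a]) bs" using ex_compatible by blast
    then have bd: "distinct bs" and bset: "set bs = {b. covers P a b}"
      by (simp_all add: compatible_def)
    have "first_closed (interval P a (ptop P)) bs {x. early as a x}"
      unfolding first_closed_def
    proof (intro ballI impI)
      fix y b assume y: "y \<in> interval P a (ptop P)"
        and b: "b \<in> set bs" "b \<le> y \<and> b \<in> {x. early as a x}"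
      let ?h = "hd (filter (\<lambda>b. b \<le> y) bs)"
      have "covers P a b" using b bset by blast
      then have ay: "a < y" using b(2) by (auto dest!: coversD)
      have yP: "y \<in> P" using y by (simp add: interval_def)
      have ey: "early as a y" using b(2) unfolding early_def by (auto intro: less_le_trans)
      obtain f c where f: "first a y (r @ [a]) (a # f # c)" "covers P a f" "f \<le> y"
        using fst[OF ua yP ay] by blast
      have ri: "rooted_interval P a y (r @ [a])"
        using ra yP ay by (simp add: rooted_interval_iff)
      have fbs: "f \<in> set bs" using f(2) bset by blast
      have h: "?h \<in> set bs" "?h \<le> y" "f = ?h \<or> before bs ?h f"
        using hd_filter_before[OF bd fbs, of "\<lambda>b. b \<le> y"] f(3) by auto
      have "?h = f \<or> before bs f ?h"
        using first_before[OF ri f(1) bs _ h(2)] h(1) bset by blast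
      then have "?h = f" using h(3) before_trans[OF bd] before_irrefl[OF bd] by metis
      then show "?h \<in> {x. early as a x}"
        using first_step_early[OF r ua as yP ay ey f(1)] by simp
    qed
    then show "\<exists>bs. grao (interval ?S a (ptop P)) bs \<and>
        first_closed (interval ?S a (ptop P)) bs {x. early as a x}"
      unfolding I using 1(1)[OF ua ra a(2) bs] by blast
  next
    fix a y assume *: "a \<in> set as \<and> y \<in> ?S \<and> a < y \<and> early as a y"
    then have ua: "covers P u a" and y: "y \<in> P" "a < y" "y \<le> ptop P"
      using set by (auto simp: interval_def)
    obtain f c where f: "first a y (r @ [a]) (a # f # c)" "covers P a f" "f \<le> y"
      using fst[OF ua y(1,2)] by blast
    have "covers ?S a f"
      using ua f y unfolding covers_interval by (auto dest: coversD)
    then show "\<exists>z. covers ?S a z \<and> early as a z \<and> z \<le> y"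
      using first_step_early[OF r ua as y(1,2) _ f(1)] * f(3) by blast
  qed
  then show ?case using grao_condI[OF S(1)] S(2,3) 1(3) by simp
qed

lemma TCL_self_consistent_imp_GRAO:
  assumes "poset_length P \<ge> 1"
  shows "admits_GRAO P"
proof -
  have "interval P (pbot P) (ptop P) = P"
    using bot_le le_top by (auto simp: interval_def)
  moreover have "pbot P \<noteq> ptop P" using poset_length_pos_iff[OF fbp] assms by simp
  moreover obtain as where "compatible (pbot P) [pbot P] as" using ex_compatible by blast
  moreover have "root [pbot P] (pbot P)" by simp
  ultimately have "grao P as" using compatible_grao by metis
  then show ?thesis unfolding admits_GRAO_def by blast
qed

end

end

section \<open>From recursive atom orderings to CL-labelings\<close>

text \<open>Roots grow at the end while \<open>path\<close> recurses at the front. The auxiliary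
  claim bridges this by continuing an arbitrary root \<open>s\<close> along a path.\<close>

lemma (in bounded_poset) root_induct [consumes 1, case_names bot step]:
  assumes "root r u" and "Prop [pbot P] (pbot P)"
    and step: "\<And>r u a. root r u \<Longrightarrow> Prop r u \<Longrightarrow> covers P u a \<Longrightarrow> Prop (r @ [a]) a"
  shows "Prop r u"
proof -
  have *: "Prop (s @ tl c) w" if "path P v w c" "root s v" "Prop s v" for v w c s
    using that
  proof (induction c arbitrary: v s)
    case (Cons x c)
    show ?case
    proof (cases c)
      case Nil
      then show ?thesis using Cons by auto
    next
      case c: (Cons a c')
      then have a: "covers P v a" "path P a w c" using Cons.prems by auto
      show ?thesis
        using Cons.IH[OF a(2) path_snoc[OF Cons.prems(2) a(1)] step[OF Cons.prems(2,3) a(1)]] c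
        by simp
    qed
  qed auto
  obtain c where "r = pbot P # c" using path_hd[OF assms(1)] by blast
  then show ?thesis using *[OF assms(1) _ assms(2)] by simp
qed

text \<open>To be added to the label of the edge below: negative exactly on the initial segment \<open>F\<close> of \<open>as\<close>.
  The choice of \<open>m\<close> is meaningful only if \<open>F\<close> is an initial segment.\<close>

definition rel_label :: "'b list \<Rightarrow> 'b set \<Rightarrow> 'b \<Rightarrow> int" where
  "rel_label as F a =
     (let m = (SOME m. set (take m as) = {x \<in> set as. x \<in> F});
          p = length (takeWhile (\<lambda>x. x \<noteq> a) as)
      in if p < m then int p - int m else int p - int m + 1)"

lemma length_takeWhile_before:
  "distinct as \<Longrightarrow> before as a b \<Longrightarrow>
    length (takeWhile (\<lambda>x. x \<noteq> a) as) < length (takeWhile (\<lambda>x. x \<noteq> b) as)"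
  by (induction as) (auto dest: before_mem)

lemma length_takeWhile_take:
  "a \<in> set as \<Longrightarrow> length (takeWhile (\<lambda>x. x \<noteq> a) as) < m \<longleftrightarrow> a \<in> set (take m as)"
proof (induction as arbitrary: m)
  case (Cons x as)
  then show ?case by (cases m) auto
qed simp

lemma rel_label_before:
  assumes "distinct as" "before as a b"
  shows "rel_label as F a < rel_label as F b"
  using length_takeWhile_before[OF assms] by (simp add: rel_label_def Let_def)

text \<open>This is the purpose of the shift by one behind the initial segment: an offset 0 would
  give consecutive edges equal labels, not an ascent although the atom is not early.\<close>

lemma rel_label_nonzero: "rel_label as F a \<noteq> 0"
  by (simp add: rel_label_def Let_def)

lemma rel_label_neg_iff:
  assumes "set (take m as) = {x \<in> set as. x \<in> F}" "a \<in> set as"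
  shows "rel_label as F a < 0 \<longleftrightarrow> a \<in> F"
proof -
  define n where "n = (SOME m. set (take m as) = {x \<in> set as. x \<in> F})"
  have "set (take n as) = {x \<in> set as. x \<in> F}"
    unfolding n_def using assms(1) by (rule someI)
  then have "length (takeWhile (\<lambda>x. x \<noteq> a) as) < n \<longleftrightarrow> a \<in> F"
    using length_takeWhile_take[OF assms(2)] assms(2) by simp
  then show ?thesis unfolding rel_label_def n_def[symmetric] Let_def by auto
qed

text \<open>A choice of orderings for a recursive atom ordering starting with \<open>as\<close>, the atoms that have to
  come first in them, and the resulting labels. The arguments are roots listed in decreasing order.\<close>

fun rao_order :: "'a::order set \<Rightarrow> 'a list \<Rightarrow> 'a list \<Rightarrow> 'a list" where
  "rao_order P as (a # u # r) =
     (SOME bs. rao (interval P a (ptop P)) bs \<and>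
        (\<exists>m. set (take m bs) =
          {x \<in> atoms (interval P a (ptop P)). early (rao_order P as (u # r)) a x}))"
| "rao_order P as r = as"

fun rao_early :: "'a::order set \<Rightarrow> 'a list \<Rightarrow> 'a list \<Rightarrow> 'a set" where
  "rao_early P as (a # u # r) = {x. early (rao_order P as (u # r)) a x}"
| "rao_early P as r = {}"

fun rao_label :: "'a::order set \<Rightarrow> 'a list \<Rightarrow> 'a list \<Rightarrow> int" where
  "rao_label P as (a # u # r) = rao_label P as (u # r) +
     rel_label (rao_order P as (u # r)) (rao_early P as (u # r)) a"
| "rao_label P as r = 0"

lemma takeWhile_neq_nth:
  "distinct c \<Longrightarrow> n < length c \<Longrightarrow> takeWhile (\<lambda>x. x \<noteq> c ! n) c = take n c"
proof (induction c arbitrary: n)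
  case (Cons x c)
  then show ?case by (cases n) auto
qed simp

text \<open>Labels are computed as integers; \<open>f\<close> transports them, with their order,
  into the prescribed label type.\<close>

locale rao_poset = bounded_poset P for P :: "'a::order set" +
  fixes as0 :: "'a list" and f :: "int \<Rightarrow> 'q"
  assumes rao: "rao P as0" and inj: "inj f"
begin

abbreviation "ord r \<equiv> rao_order P as0 (rev r)"

definition lab :: "'a list \<Rightarrow> int" where
  "lab r = rao_label P as0 (rev r)"

lemma root_rev:
  assumes "root r u"
  shows "\<exists>r'. rev r = u # r'"
proof -
  have "r \<noteq> []" "last r = u" using path_last[OF assms] path_hd[OF assms] by auto
  then obtain s where "r = s @ [u]" by (metis append_butlast_last_id)
  then show ?thesis by simp
qed

lemma interval_up:
  assumes "u \<in> P"
  shows "finite_bounded_poset (interval P u (ptop P))" "ptop (interval P u (ptop P)) = ptop P"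
    "atoms (interval P u (ptop P)) = {a. covers P u a}"
proof -
  have u: "u \<le> ptop P" using le_top assms .
  show "finite_bounded_poset (interval P u (ptop P))" "ptop (interval P u (ptop P)) = ptop P"
    using finite_bounded_poset_interval[OF finP assms top_mem u] ptop_interval[OF top_mem u] by simp_all
  show "atoms (interval P u (ptop P)) = {a. covers P u a}"
    using atoms_interval[OF assms u] le_top by (auto dest: coversD)
qed

text \<open>Justifies the choice made in \<open>rao_order\<close>: an RAO ordering at
  \<open>u\<close> guarantees a suitable one at \<open>a\<close>.\<close>

lemma ord_next_ex:
  assumes r: "root r u" and rao: "rao (interval P u (ptop P)) (ord r)" and ua: "covers P u a"
  shows "rao (interval P a (ptop P)) (ord (r @ [a])) \<and>
    (\<exists>m. set (take m (ord (r @ [a]))) = {x \<in> atoms (interval P a (ptop P)). early (ord r) a x})"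
proof -
  note I = interval_up[OF root_mem[OF r]]
  have c: "rao_cond (interval P u (ptop P)) (ord r)" using rao rao_iff[OF I(1)] by simp
  then have "a \<in> set (ord r)" using ua I(3) by (simp add: rao_cond_def atom_ordering_def)
  then obtain bs m where bs: "rao (interval (interval P u (ptop P)) a (ptop P)) bs"
    "set (take m bs) = {x \<in> atoms (interval (interval P u (ptop P)) a (ptop P)). early (ord r) a x}"
    using rao_condE[OF c] unfolding I(2) by blast
  have "interval (interval P u (ptop P)) a (ptop P) = interval P a (ptop P)"
    using ua by (intro interval_interval) (auto dest: coversD)
  note bs = bs[unfolded this]
  obtain r' where r': "rev r = u # r'" using root_rev[OF r] by blast
  then have "ord (r @ [a]) = (SOME bs. rao (interval P a (ptop P)) bs \<and>
        (\<exists>m. set (take m bs) = {x \<in> atoms (interval P a (ptop P)). early (ord r) a x}))"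
    by simp
  then show ?thesis
    using someI_ex[of "\<lambda>bs. rao (interval P a (ptop P)) bs \<and>
        (\<exists>m. set (take m bs) = {x \<in> atoms (interval P a (ptop P)). early (ord r) a x})"] bs
    by (simp only:) blast
qed

lemma rao_ord: "root r u \<Longrightarrow> rao (interval P u (ptop P)) (ord r)"
proof (induction r u rule: root_induct)
  case bot
  have "interval P (pbot P) (ptop P) = P"
    using bot_le le_top by (auto simp: interval_def)
  then show ?case using rao by simp
next
  case (step r u a)
  then show ?case using ord_next_ex by blast
qed

lemma ord_set:
  assumes "root r u"
  shows "distinct (ord r)" "set (ord r) = {a. covers P u a}"
proof -
  note I = interval_up[OF root_mem[OF assms]]
  have "rao_cond (interval P u (ptop P)) (ord r)" using rao_ord[OF assms] rao_iff[OF I(1)] by simp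
  then show "distinct (ord r)" "set (ord r) = {a. covers P u a}"
    using I(3) by (simp_all add: rao_cond_def atom_ordering_def)
qed

lemma ord_early:
  assumes r: "root r u" and "covers P u a" "y \<in> P" "a < y" "early (ord r) a y"
  shows "\<exists>z. covers P a z \<and> early (ord r) a z \<and> z \<le> y"
proof -
  note I = interval_up[OF root_mem[OF r]]
  have c: "rao_cond (interval P u (ptop P)) (ord r)" using rao_ord[OF r] rao_iff[OF I(1)] by simp
  have a: "a \<in> set (ord r)" using ord_set[OF r] assms(2) by simp
  have "u < a" using assms(2) coversD by blast
  then have "u \<le> y" using assms(4) by simp
  then have "y \<in> interval P u (ptop P)" using assms(3) le_top by (simp add: interval_def)
  then obtain z where "covers (interval P u (ptop P)) a z" "early (ord r) a z" "z \<le> y"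
    using rao_cond_early[OF c a _ assms(4,5)] by blast
  then show ?thesis unfolding covers_interval by blast
qed

lemma lab_snoc: "root r u \<Longrightarrow> lab (r @ [a]) = lab r + rel_label (ord r) (rao_early P as0 (rev r)) a"
  using root_rev unfolding lab_def by fastforce

lemma lab_before:
  assumes "root r u" "before (ord r) a b"
  shows "lab (r @ [a]) < lab (r @ [b])"
  using rel_label_before[OF ord_set(1)[OF assms(1)] assms(2)] lab_snoc[OF assms(1)] by simp

lemma lab_descent:
  assumes r: "root r u" and ua: "covers P u a" and ab: "covers P a b"
  shows "lab (r @ [a, b]) < lab (r @ [a]) \<longleftrightarrow> early (ord r) a b"
    and "lab (r @ [a, b]) \<noteq> lab (r @ [a])"
proof -
  have ra: "root (r @ [a]) a" using path_snoc[OF r ua] .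
  obtain r' where r': "rev r = u # r'" using root_rev[OF r] by blast
  have F: "rao_early P as0 (rev (r @ [a])) = {x. early (ord r) a x}" using r' by simp
  have a: "a \<in> P" using ua coversD by blast
  obtain m where "set (take m (ord (r @ [a]))) = {x \<in> {x. covers P a x}. early (ord r) a x}"
    using ord_next_ex[OF r rao_ord[OF r] ua] unfolding interval_up(3)[OF a] by blast
  then have m: "set (take m (ord (r @ [a]))) =
      {x \<in> set (ord (r @ [a])). x \<in> rao_early P as0 (rev (r @ [a]))}"
    unfolding ord_set(2)[OF ra] F by simp
  have b: "b \<in> set (ord (r @ [a]))" using ord_set(2)[OF ra] ab by simp
  have l: "lab (r @ [a, b]) = lab (r @ [a]) +
      rel_label (ord (r @ [a])) (rao_early P as0 (rev (r @ [a]))) b"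
    using lab_snoc[OF ra, of b] by simp
  show "lab (r @ [a, b]) < lab (r @ [a]) \<longleftrightarrow> early (ord r) a b"
    unfolding l using rel_label_neg_iff[OF m b] unfolding F by simp
  show "lab (r @ [a, b]) \<noteq> lab (r @ [a])"
    unfolding l by (simp add: rel_label_nonzero)
qed

text \<open>The elements of \<open>c\<close> before \<open>y\<close>, followed by \<open>y\<close>,
  are the root of \<open>y\<close> inside \<open>c\<close>. Hence the label depends only on an
  initial segment of \<open>c\<close>.\<close>

definition edge_label :: "'a list \<times> 'a \<times> 'a \<Rightarrow> 'q" where
  "edge_label = (\<lambda>(c, x, y). f (lab (takeWhile (\<lambda>z. z \<noteq> y) c @ [y])))"

definition label_order :: "'q rel" where
  "label_order = {(f x, f y) | x y. x \<le> y}"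

lemma label_order_iff: "(f x, f y) \<in> label_order \<longleftrightarrow> x \<le> y"
  using inj by (auto simp: label_order_def inj_eq)

lemma edge_label_cel: "chain_edge_labeling P (range f) label_order edge_label"
  unfolding chain_edge_labeling_def
proof (intro conjI ballI allI impI)
  show "partial_order_on (range f) label_order"
    unfolding partial_order_on_def preorder_on_def
  proof (intro conjI)
    show "refl_on (range f) label_order"
      using label_order_iff by (auto simp: refl_on_def)
    show "label_order \<subseteq> range f \<times> range f" by (auto simp: label_order_def)
    show "trans label_order"
    proof (rule transI)
      fix x y z assume "(x, y) \<in> label_order" "(y, z) \<in> label_order"
      then show "(x, z) \<in> label_order"
        using inj unfolding label_order_def by (fastforce simp: inj_eq)
    qed
    show "antisym label_order"
      using inj unfolding label_order_def antisym_def by (fastforce simp: inj_eq)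
  qed
  show "edge_label e \<in> range f" for e by (auto simp: edge_label_def split: prod.split)
  fix c c' d i
  assume *: "maximal_chain P c \<and> maximal_chain P c' \<and> d < length c \<and> d < length c' \<and>
        take (Suc d) c = take (Suc d) c'" and i: "i < d"
  have dist: "distinct c" if "maximal_chain P c" for c
  proof -
    have "sorted_wrt (<) c" using that by (simp add: maximal_chain_def chain_in_def)
    then show ?thesis by (induction c) auto
  qed
  have nth: "c ! i = c' ! i" "c ! Suc i = c' ! Suc i"
    using * i by (metis less_SucI nth_take, metis Suc_less_eq nth_take)
  have "take (Suc i) c = take (Suc i) (take (Suc d) c)" using i by (simp add: min_def)
  also have "\<dots> = take (Suc i) c'" using * i by (simp add: min_def)
  finally have tk: "take (Suc i) c = take (Suc i) c'" .
  have "takeWhile (\<lambda>z. z \<noteq> c ! Suc i) c = takeWhile (\<lambda>z. z \<noteq> c' ! Suc i) c'"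
    using takeWhile_neq_nth[OF dist[of c], of "Suc i"] takeWhile_neq_nth[OF dist[of c'], of "Suc i"] tk * i
    by simp
  then show "edge_label (c, c ! i, c ! Suc i) = edge_label (c', c' ! i, c' ! Suc i)"
    unfolding edge_label_def using nth by simp
qed

sublocale chain_labeled P "range f" label_order edge_label
  by unfold_locales (rule edge_label_cel)

lemma elab_eq:
  assumes r: "root r u" and ua: "covers P u a"
  shows "elab r a = f (lab (r @ [a]))"
proof -
  define m where "m = (SOME m. maximal_chain P m \<and> prefix (r @ [a]) m)"
  have ra: "root (r @ [a]) a" using path_snoc[OF r ua] .
  have m: "prefix (r @ [a]) m" "maximal_chain P m"
    unfolding m_def using someI_ex[OF ex_maximal_chain[OF ra]] by blast+
  have "a \<notin> set r" using path_set[OF r, of a] ua by (auto dest: coversD simp: less_le_not_le)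
  moreover obtain n where "m = r @ a # n" using m(1) by (auto simp: prefix_def)
  ultimately have "takeWhile (\<lambda>z. z \<noteq> a) m = r"
    by (auto simp: takeWhile_append)
  then have "edge_label (m, last r, a) = f (lab (r @ [a]))" by (simp add: edge_label_def)
  then show ?thesis by (simp add: elab_def label_seq_def Let_def m_def)
qed

lemma lt_iff: "lt (f x) (f y) \<longleftrightarrow> x < y"
  using label_order_iff inj by (auto simp: lt_def inj_eq)

lemma elab_before:
  assumes "root r u" "before (ord r) a b"
  shows "lt (elab r a) (elab r b)"
proof -
  have "covers P u a" "covers P u b" using before_mem[OF assms(2)] ord_set[OF assms(1)] by auto
  then show ?thesis using elab_eq[OF assms(1)] lt_iff lab_before[OF assms] by simp
qed

lemma elab_ascent_iff:
  assumes "root r u" "covers P u a" "covers P a b"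
  shows "lt (elab r a) (elab (r @ [a]) b) \<longleftrightarrow> \<not> early (ord r) a b"
  using lab_descent[OF assms] elab_eq[OF assms(1,2)] elab_eq[OF path_snoc[OF assms(1,2)] assms(3)] lt_iff
  by auto

lemma elab_inj:
  assumes "root r u" "covers P u a" "covers P u b" "elab r a = elab r b"
  shows "a = b"
proof (rule ccontr)
  assume "a \<noteq> b"
  then have "before (ord r) a b \<or> before (ord r) b a"
    using before_total[of a "ord r" b] ord_set[OF assms(1)] assms(2,3) by simp
  then show False using elab_before[OF assms(1)] assms(4) lt_irrefl by metis
qed

lemma rao_UE: "UE_property P label_order edge_label"
  unfolding UE_iff
proof (intro allI impI)
  fix u v r assume *: "rooted_interval P u v r \<and> u < v"
  then have r: "root r u" and v: "v \<in> P" by (simp_all add: rooted_interval_iff)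
  note o = ord_set[OF r]
  obtain x where x: "covers P u x" "x \<le> v" using ex_cover_le[OF finP root_mem[OF r] v] * by blast
  let ?h = "hd (filter (\<lambda>b. b \<le> v) (ord r))"
  have h: "?h \<in> set (ord r)" "?h \<le> v"
    using hd_filter_before[OF o(1), of x "\<lambda>b. b \<le> v"] x o(2) by auto
  have "lt (elab r ?h) (elab r b)" if b: "covers P u b \<and> b \<le> v \<and> b \<noteq> ?h" for b
    using hd_filter_before(3)[OF o(1), of b "\<lambda>b. b \<le> v"] b o(2) elab_before[OF r] by auto
  then show "\<exists>a. covers P u a \<and> a \<le> v \<and>
      (\<forall>b. covers P u b \<and> b \<le> v \<and> b \<noteq> a \<longrightarrow> lt (elab r a) (elab r b))"
    using h o(2) by blast
qed

section \<open>First chains and ascending chains of the constructed labeling\<close>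

lemma rao_first_before:
  assumes ri: "rooted_interval P u v r" and f: "first u v r (u # a # c)"
    and b: "covers P u b" "b \<le> v" "b \<noteq> a"
  shows "before (ord r) a b"
proof (rule ccontr)
  assume "\<not> before (ord r) a b"
  have r: "root r u" and v: "v \<in> P" using ri by (simp_all add: rooted_interval_iff)
  have p: "path P u v (u # a # c)" using f first_iff[OF ri] by blast
  then have a: "covers P u a" by simp
  have "before (ord r) b a"
    using before_total[of a "ord r" b] ord_set[OF r] a b \<open>\<not> before (ord r) a b\<close> by auto
  then have lt: "lt (elab r b) (elab r a)" using elab_before[OF r] by blast
  have "b \<in> P" using b coversD by blast
  then obtain d where d: "path P b v d" using ex_path[OF finP _ v b(2)] by blast
  then obtain d' where d': "d = b # d'" using path_hd by blast
  then have pb: "path P u v (u # b # d')" using b d by simp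
  then have "lex_earlier label_order (L r (u # a # c)) (L r (u # b # d'))" using f b(3) first_iff[OF ri] by blast
  then have "lt (elab r a) (elab r b) \<or> elab r a = elab r b"
    using L_Cons[OF r p] L_Cons[OF r pb] by (auto simp: earlier_Cons)
  then show False using lt lt_trans lt_irrefl by metis
qed

text \<open>A descent from \<open>a\<close> to \<open>b\<close> would put \<open>b\<close>, and with
  it \<open>v\<close>, above an atom preceding \<open>a\<close>; but the first chain starts with the
  first atom below \<open>v\<close>.\<close>

lemma rao_first_ascending:
  assumes "rooted_interval P u v r" "first u v r c"
  shows "ascending P label_order edge_label r c"
  using assms
proof (induction c arbitrary: u r)
  case (Cons x c)
  note ri = Cons.prems(1) and f = Cons.prems(2)
  have r: "root r u" using ri by (simp add: rooted_interval_iff)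
  have p: "path P u v (x # c)" using f first_iff[OF ri] by blast
  show ?case
  proof (cases c)
    case Nil
    then show ?thesis by (simp add: ascending_single)
  next
    case c: (Cons a c')
    then have a: "x = u" "covers P u a" "path P a v (a # c')" using p by auto
    show ?thesis
    proof (cases c')
      case Nil
      then show ?thesis using c a ascending_two[OF r] by simp
    next
      case c': (Cons b c'')
      have ab: "covers P a b" "b \<le> v" using a c' path_le by auto
      have "\<not> early (ord r) a b"
      proof
        assume "early (ord r) a b"
        then obtain k where k: "before (ord r) k a" "k < b" unfolding early_def by blast
        have "covers P u k" using before_mem[OF k(1)] ord_set[OF r] by blast
        moreover have "k \<le> v" using k(2) ab(2) by simp
        moreover have "k \<noteq> a" using k(1) before_irrefl[OF ord_set(1)[OF r]] by blast
        ultimately have "before (ord r) a k" using rao_first_before[OF ri] f c a(1) by blast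
        then show False
          using k(1) before_trans[OF ord_set(1)[OF r]] before_irrefl[OF ord_set(1)[OF r]] by blast
      qed
      then have "lt (elab r a) (elab (r @ [a]) b)" using elab_ascent_iff[OF r a(2) ab(1)] by simp
      moreover have "ascending P label_order edge_label (r @ [a]) c"
        using Cons.IH[OF rooted_step[OF ri a(2) path_le[OF a(3)]]] first_tail[OF ri] f c a(1) by simp
      ultimately have "ascending P label_order edge_label r (u # a # b # c'')"
        using ascending_Cons[OF r p[unfolded c c' a(1)]] c c' by blast
      then show ?thesis using c c' a(1) by simp
    qed
  qed
qed (simp add: lex_first_def ascending_def label_seq_def Let_def)

text \<open>By induction the tail is first in [a, v]. If \<open>a\<close> were not the first atom
  below \<open>v\<close>, condition (ii) would yield an early cover \<open>z\<close> of
  \<open>a\<close> below \<open>v\<close>. Early covers come first, so \<open>b\<close> would be a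
  descent.\<close>

lemma rao_ascending_first:
  assumes "rooted_interval P u v r" "path P u v c" "ascending P label_order edge_label r c"
  shows "first u v r c"
  using assms
proof (induction c arbitrary: u r)
  case (Cons x c)
  note ri = Cons.prems(1) and p = Cons.prems(2) and asc = Cons.prems(3)
  have r: "root r u" and v: "v \<in> P" using ri by (simp_all add: rooted_interval_iff)
  show ?case
  proof (cases c)
    case Nil
    then show ?thesis using p first_refl[OF r] by auto
  next
    case c: (Cons a c')
    then have a: "x = u" "covers P u a" "path P a v (a # c')" using p by auto
    have ra: "root (r @ [a]) a" using path_snoc[OF r a(2)] .
    have ria: "rooted_interval P a v (r @ [a])"
      using rooted_step[OF ri a(2) path_le[OF a(3)]] .
    show ?thesis
    proof (cases c')
      case Nil
      then have "v = a" using a(3) by simp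
      then show ?thesis using c Nil a first_iff[OF ri] path_cover[OF a(2)] by auto
    next
      case c': (Cons b c'')
      have ab: "covers P a b" "b \<le> v" using a c' path_le by auto
      then have av: "a < v" by (auto dest!: coversD)
      have step: "lt (elab r a) (elab (r @ [a]) b)"
        and tail: "ascending P label_order edge_label (r @ [a]) (a # c')"
        using ascending_Cons[OF r p[unfolded c c' a(1)]] asc[unfolded c c' a(1)] c' by blast+
      then have fa: "first a v (r @ [a]) (a # b # c'')"
        using Cons.IH[OF ria] a(3) c c' by simp
      obtain e where e: "first u v r e" using UE_first[OF rao_UE ri] by blast
      then have pe: "path P u v e" using first_iff[OF ri] by blast
      have "u \<noteq> v" using a(2) av by (auto dest: coversD)
      then obtain g e' where g: "e = u # g # e'" "covers P u g" "path P g v (g # e')"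
        using path_neqE[OF pe] by blast
      have "g = a"
      proof (rule ccontr)
        assume "g \<noteq> a"
        then have ga: "before (ord r) g a"
          using rao_first_before[OF ri _ a(2)] e g(1) av by auto
        \<comment> \<open>\<open>v\<close> does not cover \<open>u\<close>, because \<open>a\<close>
          lies strictly between. So \<open>g < v\<close>, as \<open>early\<close> requires.\<close>
        have "g \<noteq> v" using g(2) a(2) av by (auto simp: covers_def)
        then have "early (ord r) a v"
          using ga path_le[OF g(3)] unfolding early_def by (auto simp: less_le)
        then obtain z where z: "covers P a z" "early (ord r) a z" "z \<le> v"
          using ord_early[OF r a(2) v av] by blast
        have nb: "\<not> early (ord r) a b" using step elab_ascent_iff[OF r a(2) ab(1)] by simp
        then have "z \<noteq> b" using z(2) by blast
        then have "before (ord (r @ [a])) b z" using rao_first_before[OF ria fa z(1,3)] by simp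
        \<comment> \<open>\<open>b\<close> starts the first chain of [a, v], hence has a smaller
          label than \<open>z\<close>, which in turn is below the label of \<open>a\<close>.\<close>
        then have "lab (r @ [a, b]) < lab (r @ [a, z])" using lab_before[OF ra] by simp
        also have "\<dots> < lab (r @ [a])" using lab_descent(1)[OF r a(2) z(1)] z(2) by simp
        finally show False using lab_descent(1)[OF r a(2) ab(1)] nb by simp
      qed
      then have "first a v (r @ [a]) (a # e')" using first_tail[OF ri] e g(1) by simp
      then have "a # e' = a # b # c''" using fa first_unique by blast
      then show ?thesis using e g(1) \<open>g = a\<close> c c' a(1) by simp
    qed
  qed
qed simp

lemma rao_CL: "CL_labeling P (range f) label_order edge_label"
  unfolding CL_labeling_def
proof (intro conjI allI impI)
  fix u v r assume ri: "rooted_interval P u v r"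
  obtain c where c: "first u v r c" using UE_first[OF rao_UE ri] by blast
  have pc: "path P u v c" using c first_iff[OF ri] by blast
  have asc: "d = c" if "path P u v d" "ascending P label_order edge_label r d" for d
    using rao_ascending_first[OF ri that] c first_unique by blast
  show "\<exists>!c. saturated_chain P u v c \<and> ascending P label_order edge_label r c"
    unfolding sat_iff[OF ri] using pc rao_first_ascending[OF ri c] asc by blast
  show "first u v r d" if "saturated_chain P u v d \<and> ascending P label_order edge_label r d" for d
    using that rao_ascending_first[OF ri] sat_iff[OF ri] by blast
qed (rule edge_label_cel)

lemma rao_CC: "CC_labeling P (range f) label_order edge_label"
  by (rule CL_CC[OF rao_CL elab_inj])

end

section \<open>The equivalences\<close>

lemma RAO_imp_labeling:
  assumes "finite_bounded_poset P" "admits_RAO P" "infinite (UNIV :: 'q set)"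
  shows "\<exists>(Q :: 'q set) R lam. CL_labeling P Q R lam \<and> CC_labeling P Q R lam \<and> UE_property P R lam"
proof -
  obtain as where as: "rao P as" using assms(2) by (auto simp: admits_RAO_def)
  obtain g :: "nat \<Rightarrow> 'q" where "inj g" using infinite_countable_subset[OF assms(3)] by blast
  \<comment> \<open>\<open>int_encode\<close> maps the integers injectively to the naturals, a copy
    of which lies in every infinite type.\<close>
  then have "inj (g \<circ> int_encode)" using inj_int_encode by (intro inj_compose)
  then interpret rao_poset P as "g \<circ> int_encode"
    using assms(1) as by unfold_locales
  show ?thesis using rao_CL rao_CC rao_UE by blast
qed

lemma self_consistent_TCL_imp_GRAO:
  assumes "finite_bounded_poset P" "TCL_labeling P Q R lam" "self_consistent P R lam"
    "poset_length P \<ge> 1"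
  shows "admits_GRAO P"
proof -
  interpret chain_labeled P Q R lam
    using assms(1,2) by unfold_locales (simp_all add: TCL_labeling_def)
  show ?thesis by (rule TCL_self_consistent_imp_GRAO[OF assms(2,3,4)])
qed

lemma self_consistent_CC_imp_TCL:
  assumes "finite_bounded_poset P" "CC_labeling P Q R lam" "self_consistent P R lam"
  shows "TCL_labeling P Q R lam"
proof -
  interpret chain_labeled P Q R lam
    using assms(1,2) by unfold_locales (simp_all add: CC_labeling_def)
  show ?thesis
    by (rule CC_TCL[OF assms(2)]) (use assms(3) in \<open>unfold self_consistent_def, blast\<close>)
qed

lemma UE_imp_self_consistent:
  assumes "finite_bounded_poset P" "chain_edge_labeling P Q R lam" "UE_property P R lam"
  shows "self_consistent P R lam"
proof -
  interpret chain_labeled P Q R lam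
    using assms(1,2) by unfold_locales
  show ?thesis by (rule UE_self_consistent[OF assms(3)])
qed

lemma CL_imp_TCL_UE:
  assumes "finite_bounded_poset P" "CL_labeling P Q R lam"
  shows "TCL_labeling P Q R lam" "UE_property P R lam"
proof -
  interpret chain_labeled P Q R lam
    using assms(1,2) by unfold_locales (simp_all add: CL_labeling_def)
  show "TCL_labeling P Q R lam" "UE_property P R lam"
    by (rule CL_TCL[OF assms(2)], rule CL_UE[OF assms(2)])
qed

theorem theorem6p4:
  fixes P :: "'a::order set"
  assumes "finite_bounded_poset P"
    and "poset_length P \<ge> 1"
    and "infinite (UNIV :: 'q set)"
  shows
    "(admits_RAO P \<longleftrightarrow> admits_GRAO P) \<and>
     (admits_RAO P \<longleftrightarrow> (\<exists>(Q :: 'q set) R lam. CL_labeling P Q R lam)) \<and>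
     (admits_RAO P \<longleftrightarrow> (\<exists>(Q :: 'q set) R lam. CL_labeling P Q R lam \<and> UE_property P R lam)) \<and>
     (admits_RAO P \<longleftrightarrow> (\<exists>(Q :: 'q set) R lam. CC_labeling P Q R lam \<and> self_consistent P R lam)) \<and>
     (admits_RAO P \<longleftrightarrow> (\<exists>(Q :: 'q set) R lam. CC_labeling P Q R lam \<and> UE_property P R lam)) \<and>
     (admits_RAO P \<longleftrightarrow> (\<exists>(Q :: 'q set) R lam. TCL_labeling P Q R lam \<and> self_consistent P R lam)) \<and>
     (admits_RAO P \<longleftrightarrow> (\<exists>(Q :: 'q set) R lam. TCL_labeling P Q R lam \<and> UE_property P R lam))"
proof -
  have TCL: "admits_RAO P" if "TCL_labeling P Q R lam" "self_consistent P R lam"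
    for Q :: "'q set" and R lam
    using self_consistent_TCL_imp_GRAO[OF assms(1) that assms(2)] admits_RAO_iff_GRAO[OF assms(1,2)] by simp
  have TCL_UE: "admits_RAO P" if "TCL_labeling P Q R lam" "UE_property P R lam"
    for Q :: "'q set" and R lam
  proof -
    have "chain_edge_labeling P Q R lam" using that(1) by (simp add: TCL_labeling_def)
    then show ?thesis by (rule TCL[OF that(1) UE_imp_self_consistent[OF assms(1) _ that(2)]])
  qed
  have CC: "admits_RAO P" if "CC_labeling P Q R lam" "self_consistent P R lam"
    for Q :: "'q set" and R lam
    using TCL[OF self_consistent_CC_imp_TCL[OF assms(1) that] that(2)] .
  have CC_UE: "admits_RAO P" if "CC_labeling P Q R lam" "UE_property P R lam"
    for Q :: "'q set" and R lam
  proof -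
    have "chain_edge_labeling P Q R lam" using that(1) by (simp add: CC_labeling_def)
    then show ?thesis by (rule CC[OF that(1) UE_imp_self_consistent[OF assms(1) _ that(2)]])
  qed
  have CL: "admits_RAO P" if "CL_labeling P Q R lam" for Q :: "'q set" and R lam
    using TCL_UE[OF CL_imp_TCL_UE[OF assms(1) that]] .
  have "\<exists>(Q :: 'q set) R lam. CL_labeling P Q R lam \<and> CC_labeling P Q R lam \<and>
      TCL_labeling P Q R lam \<and> UE_property P R lam \<and> self_consistent P R lam"
    if rao: "admits_RAO P"
  proof -
    obtain Q :: "'q set" and R lam where
      *: "CL_labeling P Q R lam" "CC_labeling P Q R lam" "UE_property P R lam"
      using RAO_imp_labeling[OF assms(1) rao assms(3)] by blast
    have "TCL_labeling P Q R lam" by (rule CL_imp_TCL_UE(1)[OF assms(1) *(1)])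
    moreover have "chain_edge_labeling P Q R lam" using *(1) by (simp add: CL_labeling_def)
    then have "self_consistent P R lam" by (rule UE_imp_self_consistent[OF assms(1) _ *(3)])
    ultimately show ?thesis using * by blast
  qed
  note labels = this
  show ?thesis
  proof (intro conjI)
    show "admits_RAO P \<longleftrightarrow> admits_GRAO P" by (rule admits_RAO_iff_GRAO[OF assms(1,2)])
  qed (use labels TCL TCL_UE CC CC_UE CL in metis)+
qed

end
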